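(* Let $\mathcal T$ be an unweighted tree on $n\ge5$ nodes. Then $$\frac{(n-1)^2}{2n}\ \le\ \rho_{ss}(L_{\mathcal T};M_n)\ \le\ \frac{n^2-1}{12}.$$ Moreover, the lower bound is achieved if and only if $\mathcal T=\mathcal S_n$ (the star graph on $n$ nodes), and the upper bound is achieved if and only if $\mathcal T=\mathcal P_n$ (the path graph on $n$ nodes).
   Context: Graphs are finite, simple, undirected; equality of graphs is up to isomorphism. For a connected graph $\mathcal G$ on $n$ nodes, $L_{\mathcal G}$ is the graph Laplacian (degree matrix minus adjacency matrix) with eigenvalues $0=\lambda_1<\lambda_2\le\dots\le\lambda_n$, $M_n=I_n-\frac1nJ_n$ is the centering matrix, and $\rho_{ss}(L_{\mathcal G};M_n)=\frac12\sum_{i=2}^n\lambda_i^{-1}$ is the performance measure of the first-order consensus network $\dot x=-L_{\mathcal G}x+\xi$, $y=M_nx$. *)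

theory Defs
  imports
    "Graph_Theory.Graph_Theory"
    "Jordan_Normal_Form.Char_Poly"
begin

text \<open>
  A finite simple undirected graph is a \<open>pair_graph\<close>: every edge between \<open>u\<close> and \<open>v\<close> is
  represented by the two arcs \<open>(u, v)\<close> and \<open>(v, u)\<close>. The library predicate \<open>tree\<close> is of no use
  for such graphs, because \<open>cycle\<close> admits the closed walk of length two along a single edge;
  the cycles of the undirected graph are the directed cycles of length at least three.
\<close>

definition undirected_tree :: "'a pair_pre_digraph \<Rightarrow> bool" where
  "undirected_tree G \<longleftrightarrow>
     pair_graph G \<and> connected (with_proj G) \<and>
     \<not> (\<exists>p. pre_digraph.cycle (with_proj G) p \<and> length p \<ge> 3)"

definition graph_iso :: "'a pair_pre_digraph \<Rightarrow> 'b pair_pre_digraph \<Rightarrow> bool" where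
  "graph_iso G H \<longleftrightarrow> digraph_iso (with_proj G) (with_proj H)"

definition star_graph :: "nat \<Rightarrow> nat pair_pre_digraph" where
  "star_graph n =
     \<lparr> pverts = {0..<n},
       parcs = {(i, j). i < n \<and> j < n \<and> i \<noteq> j \<and> (i = 0 \<or> j = 0)} \<rparr>"

definition path_graph :: "nat \<Rightarrow> nat pair_pre_digraph" where
  "path_graph n =
     \<lparr> pverts = {0..<n},
       parcs = {(i, j). i < n \<and> j < n \<and> (j = Suc i \<or> i = Suc j)} \<rparr>"

text \<open>The matrices below are meant for graphs whose node set is \<open>{0..<n}\<close>.\<close>

definition adjacency_matrix :: "nat pair_pre_digraph \<Rightarrow> real mat" where
  "adjacency_matrix G =
     (let n = card (pverts G) in
      mat n n (\<lambda>(i, j). if (i, j) \<in> parcs G then 1 else 0))"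

definition degree_matrix :: "nat pair_pre_digraph \<Rightarrow> real mat" where
  "degree_matrix G =
     (let n = card (pverts G) in
      mat n n (\<lambda>(i, j). if i = j then real (out_degree (with_proj G) i) else 0))"

definition laplacian :: "nat pair_pre_digraph \<Rightarrow> real mat" where
  "laplacian G = degree_matrix G - adjacency_matrix G"

text \<open>
  The \<open>i\<close>-th smallest real eigenvalue, counted with algebraic multiplicity and numbered from 1.
  For a symmetric \<open>n \<times> n\<close> matrix all \<open>n\<close> roots of the characteristic polynomial are
  real, so it is meaningful exactly for \<open>1 \<le> i \<le> n\<close>.
\<close>

definition ordered_eigenvalue :: "real mat \<Rightarrow> nat \<Rightarrow> real" where
  "ordered_eigenvalue A i = sorted_list_of_multiset (proots (char_poly A)) ! (i - 1)"

text \<open>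
  The performance measure of \<open>x' = - L x + \<xi>\<close>, \<open>y = M\<^sub>n x\<close> with Laplacian \<open>L\<close> of
  dimension \<open>n\<close> and the centering matrix \<open>M\<^sub>n = I\<^sub>n - J\<^sub>n / n\<close> as output matrix. The
  output annihilates the consensus mode, so the eigenvalue with index 1 does not contribute.
\<close>

definition rho_ss :: "real mat \<Rightarrow> real" where
  "rho_ss L = 1 / 2 * (\<Sum>i = 2..dim_row L. inverse (ordered_eigenvalue L i))"

end

theory Submission
  imports Defs "Jordan_Normal_Form.Schur_Decomposition"
begin

text \<open>
  The sum of the reciprocal nonzero Laplacian eigenvalues is the trace of the pseudoinverse of the
  Laplacian \<open>L\<close>, and for a tree this pseudoinverse can be written down from the matrix \<open>D\<close> of the
  path distances. If \<open>j \<noteq> i\<close>, exactly one neighbour of \<open>i\<close> is closer to \<open>j\<close> than \<open>i\<close> is, and all others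
  are farther away; hence \<open>L D = \<tau> 1\<^sup>T - 2 I\<close> with \<open>\<tau> i = 2 - deg i\<close>. With the centering matrix \<open>M\<close>, the
  matrix \<open>X = - M D M / 2\<close> therefore satisfies \<open>X L = M\<close> and \<open>X 1 = 0\<close>, and its trace is \<open>S / (2 n)\<close>,
  where \<open>S\<close> is the sum of the distances over all ordered pairs of nodes. So \<open>\<rho>\<^sub>s\<^sub>s = S / (4 n)\<close>
  (\<open>rho_ss_undirected_tree\<close>), and the theorem becomes a statement on the Wiener index of trees.

  Lower bound: \<open>2 (n - 1)\<close> ordered pairs of distinct nodes are adjacent and have distance 1, all others
  have distance at least 2, so \<open>S \<ge> 2 (n - 1)\<^sup>2\<close>. Equality means that no distance exceeds 2, and then the
  neighbour of any leaf is adjacent to every other node (\<open>tree_metric_total_ge\<close>,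
  \<open>tree_metric_diameter_two_iff_star\<close>).

  Upper bound: the distances from a fixed node sum to at most \<open>0 + 1 + \<dots> + (n - 1)\<close>, with equality only
  if the node is an end of a path. A new leaf adds twice its distance sum to \<open>S\<close>, so induction gives
  \<open>3 S \<le> n\<^sup>3 - n\<close>, with equality only for paths (\<open>tree_metric_total_le\<close>,
  \<open>tree_metric_total_max_iff_path\<close>).

  The basic facts on distances are proved by induction over the construction of a tree by successively
  attaching leaves. That an undirected tree arises in this way (\<open>undirected_tree_has_tree_metric\<close>) is
  where connectivity and the absence of cycles enter.
\<close>

section \<open>The trace of a centered inverse\<close>

lemma mult_mat_entry:
  assumes "A \<in> carrier_mat n n" "B \<in> carrier_mat n n" "i < n" "j < n"
  shows "(A * B) $$ (i, j) = (\<Sum>k<n. A $$ (i, k) * B $$ (k, j))"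
  using assms by (simp add: scalar_prod_def atLeast0LessThan)

lemma trace_mult_commute:
  fixes A B :: "'a::comm_semiring_0 mat"
  assumes "A \<in> carrier_mat n n" "B \<in> carrier_mat n n"
  shows "(\<Sum>i<n. (A * B) $$ (i, i)) = (\<Sum>i<n. (B * A) $$ (i, i))"
proof -
  have "(\<Sum>i<n. (A * B) $$ (i, i)) = (\<Sum>i<n. \<Sum>k<n. A $$ (i, k) * B $$ (k, i))"
    using assms by (intro sum.cong) (auto simp: mult_mat_entry simp del: index_mult_mat)
  also have "\<dots> = (\<Sum>k<n. \<Sum>i<n. B $$ (k, i) * A $$ (i, k))"
    by (subst sum.swap) (simp add: mult.commute)
  also have "\<dots> = (\<Sum>i<n. (B * A) $$ (i, i))"
    using assms by (intro sum.cong) (auto simp: mult_mat_entry simp del: index_mult_mat)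
  finally show ?thesis .
qed

lemma trace_similar:
  fixes X :: "'a::comm_ring_1 mat"
  assumes "P \<in> carrier_mat n n" "Q \<in> carrier_mat n n" "X \<in> carrier_mat n n" "P * Q = 1\<^sub>m n"
  shows "(\<Sum>i<n. (Q * X * P) $$ (i, i)) = (\<Sum>i<n. X $$ (i, i))"
proof -
  have "(\<Sum>i<n. (Q * X * P) $$ (i, i)) = (\<Sum>i<n. (P * (Q * X)) $$ (i, i))"
    using assms by (intro trace_mult_commute) auto
  also have "P * (Q * X) = (P * Q) * X"
    using assms by (intro assoc_mult_mat[symmetric])
  also have "\<dots> = X" using assms by simp
  finally show ?thesis .
qed

text \<open>
  Row \<open>i\<close> of \<open>Y\<close> is determined by forward substitution from \<open>Y B\<close>. Its entries left of the diagonal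
  vanish because the earlier diagonal entries of \<open>B\<close>, except the first, are nonzero, which the same
  argument for the earlier rows shows; the first column of \<open>Y\<close> vanishes by assumption.
\<close>

lemma left_inverse_triangular_diagonal:
  fixes Y B :: "'a::field mat"
  assumes Y: "Y \<in> carrier_mat n n" and B: "B \<in> carrier_mat n n"
    and ut: "upper_triangular B"
    and col0: "\<And>i. i < n \<Longrightarrow> Y $$ (i, 0) = 0"
    and prod: "\<And>i j. 0 < i \<Longrightarrow> i < n \<Longrightarrow> j < n \<Longrightarrow> (Y * B) $$ (i, j) = (if i = j then 1 else 0)"
    and i: "0 < i" "i < n"
  shows "Y $$ (i, i) = inverse (B $$ (i, i))"
proof -
  have ent: "(\<Sum>k\<le>j. Y $$ (i, k) * B $$ (k, j)) = (if i = j then 1 else 0)"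
    if "0 < i" "i < n" "j < n" for i j
  proof -
    have "(\<Sum>k<n. Y $$ (i, k) * B $$ (k, j)) = (\<Sum>k\<le>j. Y $$ (i, k) * B $$ (k, j))"
      using that B by (intro sum.mono_neutral_right) (auto intro!: upper_triangularD[OF ut])
    then show ?thesis using prod[OF that] mult_mat_entry[OF Y B that(2,3)] by simp
  qed
  have "Y $$ (i, i) * B $$ (i, i) = 1" if "0 < i" "i < n" for i
    using that
  proof (induction i rule: less_induct)
    case (less i)
    have low: "Y $$ (i, j) = 0" if "j < i" for j
      using that
    proof (induction j rule: less_induct)
      case (less j)
      show ?case
      proof (cases "j = 0")
        case True
        then show ?thesis using col0 \<open>i < n\<close> by simp
      next
        case False
        have "(\<Sum>k\<le>j. Y $$ (i, k) * B $$ (k, j)) = Y $$ (i, j) * B $$ (j, j)"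
          using less by (subst sum.remove[of _ j]) auto
        moreover have "(\<Sum>k\<le>j. Y $$ (i, k) * B $$ (k, j)) = 0"
          using ent[of i j] less.prems \<open>0 < i\<close> \<open>i < n\<close> by simp
        moreover have "B $$ (j, j) \<noteq> 0"
          using \<open>\<And>y. y < i \<Longrightarrow> 0 < y \<Longrightarrow> y < n \<Longrightarrow> Y $$ (y, y) * B $$ (y, y) = 1\<close>[of j]
            False less.prems \<open>i < n\<close> by auto
        ultimately show ?thesis by simp
      qed
    qed
    have "(\<Sum>k\<le>i. Y $$ (i, k) * B $$ (k, i)) = Y $$ (i, i) * B $$ (i, i)"
      using low by (subst sum.remove[of _ i]) auto
    then show ?case using ent[of i i] less.prems by simp
  qed
  from this[OF i] show ?thesis by (metis inverse_unique mult.commute)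
qed

text \<open>
  In a Schur basis whose first vector spans the kernel of \<open>A\<close>, the matrix \<open>A\<close> becomes upper triangular
  with first column 0, and \<open>X A\<close> agrees with the identity outside its first row. Hence \<open>X\<close> becomes
  triangular below the first row, with the reciprocals of the remaining eigenvalues on its diagonal.
  The trace does not depend on the basis.
\<close>

lemma sum_inverse_eigenvalues_eq_trace:
  fixes A X :: "real mat"
  assumes A: "A \<in> carrier_mat n n" and X: "X \<in> carrier_mat n n" and n: "0 < n"
    and X1: "\<And>i. i < n \<Longrightarrow> (\<Sum>k<n. X $$ (i, k)) = 0"
    and XA: "X * A = mat n n (\<lambda>(i, j). (if i = j then 1 else 0) - 1 / real n)"
    and cp: "char_poly A = (\<Prod>e\<leftarrow>0 # es. [:- e, 1:])"
  shows "sum_list (map inverse es) = (\<Sum>i<n. X $$ (i, i))"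
proof -
  obtain B P Q where "schur_decomposition A (0 # es) = (B, P, Q)"
    by (metis prod_cases3)
  from schur_decomposition[OF A cp this]
  have sim: "similar_mat_wit A B P Q" and ut: "upper_triangular B" and dg: "diag_mat B = 0 # es"
    by auto
  note s = similar_mat_witD2[OF A sim]
  note PQ = s(1) and QP = s(2) and APBQ = s(3) and B = s(5) and P = s(6) and Q = s(7)
  define M :: "real mat" where "M = mat n n (\<lambda>(i, j). (if i = j then 1 else 0) - 1 / real n)"
  have M: "M \<in> carrier_mat n n" by (simp add: M_def)
  define Y where "Y = Q * X * P"
  have Y: "Y \<in> carrier_mat n n" using P Q X by (auto simp: Y_def)
  have AP: "A * P = P * B"
  proof -
    have "A * P = P * B * (Q * P)" using APBQ P Q B by (simp add: assoc_mult_mat[of _ n n _ n _ n])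
    then show ?thesis using QP P B by simp
  qed
  have YB: "Y * B = Q * M * P"
  proof -
    have "Y * B = Q * X * (P * B)" using P Q X B by (simp add: Y_def assoc_mult_mat[of _ n n _ n _ n])
    also have "\<dots> = Q * (X * A) * P" unfolding AP[symmetric]
      using P Q X A by (simp add: assoc_mult_mat[of _ n n _ n _ n])
    finally show ?thesis using XA by (simp add: M_def)
  qed
  have len: "length (0 # es) = n" using dg B by (metis carrier_matD(1) diag_mat_def length_map length_upt diff_zero)
  have Bii: "B $$ (i, i) = (0 # es) ! i" if "i < n" for i
    using that dg B unfolding diag_mat_def by (metis (no_types, lifting) carrier_matD(1) diff_zero length_upt nth_map nth_upt add_0)
  have B0: "B $$ (k, 0) = 0" if "k < n" for k
    using that Bii[of 0] B n by (cases "k = 0") (auto intro!: upper_triangularD[OF ut])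
  (* The first basis vector is a multiple of the all-ones vector, since M maps it to 0. *)
  define c where "c = (\<Sum>k<n. P $$ (k, 0)) / real n"
  have P0: "P $$ (i, 0) = c" if i: "i < n" for i
  proof -
    have "(M * P) $$ (i, 0) = (X * (A * P)) $$ (i, 0)"
      unfolding M_def XA[symmetric] assoc_mult_mat[OF X A P] ..
    also have "\<dots> = (\<Sum>k<n. X $$ (i, k) * (P * B) $$ (k, 0))"
      unfolding AP using X P B i n by (intro mult_mat_entry) auto
    also have "\<dots> = 0"
      using P B n by (intro sum.neutral ballI)
        (auto simp: mult_mat_entry[of _ n] B0 simp del: index_mult_mat)
    finally have "(\<Sum>k<n. ((if i = k then 1 else 0) - 1 / real n) * P $$ (k, 0)) = 0"
      using mult_mat_entry[OF M P i n] i by (simp add: M_def)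
    moreover have "(\<Sum>k<n. ((if i = k then 1 else 0) - 1 / real n) * P $$ (k, 0))
      = (\<Sum>k<n. if i = k then P $$ (k, 0) else 0) - (\<Sum>k<n. P $$ (k, 0)) / real n"
      unfolding sum_divide_distrib sum_subtractf[symmetric]
      by (intro sum.cong) (auto simp: algebra_simps)
    ultimately show ?thesis using i by (simp add: c_def)
  qed
  have Q1: "c * (\<Sum>k<n. Q $$ (i, k)) = (if i = 0 then 1 else 0)" if i: "i < n" for i
  proof -
    have "(if i = 0 then 1 else 0) = (Q * P) $$ (i, 0)" using QP i n by simp
    also have "\<dots> = (\<Sum>k<n. Q $$ (i, k) * P $$ (k, 0))" using Q P i n by (rule mult_mat_entry)
    also have "\<dots> = c * (\<Sum>k<n. Q $$ (i, k))" by (simp add: P0 sum_distrib_left mult.commute)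
    finally show ?thesis by simp
  qed
  have "c \<noteq> 0" using Q1[of 0] n by auto
  then have Q1': "(\<Sum>k<n. Q $$ (i, k)) = 0" if "0 < i" "i < n" for i
    using Q1[of i] that by auto
  have Y0: "Y $$ (i, 0) = 0" if i: "i < n" for i
  proof -
    have "Y $$ (i, 0) = (Q * (X * P)) $$ (i, 0)"
      using Q X P by (simp add: Y_def assoc_mult_mat[of _ n n _ n _ n])
    also have "\<dots> = (\<Sum>k<n. Q $$ (i, k) * (X * P) $$ (k, 0))"
      using Q X P i n by (intro mult_mat_entry) auto
    also have "\<dots> = 0"
    proof (intro sum.neutral ballI)
      fix k assume "k \<in> {..<n}"
      then have "(X * P) $$ (k, 0) = (\<Sum>l<n. X $$ (k, l)) * c"
        using mult_mat_entry[OF X P _ n, of k] by (simp add: P0 sum_distrib_right)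
      then show "Q $$ (i, k) * (X * P) $$ (k, 0) = 0" using X1 \<open>k \<in> {..<n}\<close> by simp
    qed
    finally show ?thesis .
  qed
  have E: "(Y * B) $$ (i, j) = (if i = j then 1 else 0)" if i: "0 < i" "i < n" and j: "j < n" for i j
  proof -
    have QM: "(Q * M) $$ (i, k) = Q $$ (i, k)" if k: "k < n" for k
    proof -
      have "(Q * M) $$ (i, k) = (\<Sum>l<n. Q $$ (i, l) * ((if l = k then 1 else 0) - 1 / real n))"
        using mult_mat_entry[OF Q M i(2) k] k by (simp add: M_def)
      also have "\<dots> = (\<Sum>l<n. if l = k then Q $$ (i, l) else 0) - (\<Sum>l<n. Q $$ (i, l)) / real n"
        unfolding sum_divide_distrib sum_subtractf[symmetric]
        by (intro sum.cong) (auto simp: algebra_simps)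
      finally show ?thesis using Q1'[OF i] k by simp
    qed
    have "(Y * B) $$ (i, j) = (\<Sum>k<n. (Q * M) $$ (i, k) * P $$ (k, j))"
      unfolding YB using Q M P i j by (intro mult_mat_entry) auto
    also have "\<dots> = (\<Sum>k<n. Q $$ (i, k) * P $$ (k, j))" by (simp add: QM del: index_mult_mat)
    also have "\<dots> = (Q * P) $$ (i, j)" using mult_mat_entry[OF Q P i(2) j] by simp
    finally show ?thesis using QP i j by simp
  qed
  (* The entry at index 0 is covered by the convention inverse 0 = 0. *)
  have Yii: "Y $$ (i, i) = inverse ((0 # es) ! i)" if "i < n" for i
    using left_inverse_triangular_diagonal[OF Y B ut Y0 E, of i] that Y0[of 0] Bii[of i]
    by (cases "i = 0") auto
  have "(\<Sum>i<n. X $$ (i, i)) = (\<Sum>i<n. Y $$ (i, i))"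
    unfolding Y_def using trace_similar[OF P Q X PQ] by simp
  also have "\<dots> = (\<Sum>i<n. map inverse (0 # es) ! i)"
    using Yii len by (intro sum.cong) (auto simp: nth_map simp del: list.map)
  also have "\<dots> = sum_list (map inverse (0 # es))"
    using len by (simp add: sum_list_sum_nth atLeast0LessThan del: list.map)
  finally show ?thesis by simp
qed

section \<open>Laplacian spectrum and distance matrices\<close>

definition weighted_laplacian :: "nat \<Rightarrow> (nat \<Rightarrow> nat \<Rightarrow> real) \<Rightarrow> real mat" where
  "weighted_laplacian n a = mat n n (\<lambda>(i, j). (if i = j then \<Sum>k<n. a i k else 0) - a i j)"

lemma weighted_laplacian_carrier [simp]: "weighted_laplacian n a \<in> carrier_mat n n"
  by (simp add: weighted_laplacian_def)

text \<open>
  An eigenvector \<open>v\<close> satisfies \<open>2 z |v|\<^sup>2 = (\<Sum>i j. a i j * |v i - v j|\<^sup>2)\<close>. Starting from a complex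
  eigenvalue gives at once that it is real and that it is nonnegative.
\<close>

lemma eigenvalue_weighted_laplacian_nonneg:
  fixes z :: complex
  assumes sym: "\<And>i j. i < n \<Longrightarrow> j < n \<Longrightarrow> a i j = a j i"
    and nonneg: "\<And>i j. i < n \<Longrightarrow> j < n \<Longrightarrow> 0 \<le> a i j"
    and ev: "eigenvalue (map_mat complex_of_real (weighted_laplacian n a)) z"
  shows "z = of_real (Re z) \<and> 0 \<le> Re z"
proof -
  let ?L = "map_mat complex_of_real (weighted_laplacian n a)"
  have dim: "dim_row ?L = n" "dim_col ?L = n" by (simp_all add: weighted_laplacian_def)
  obtain v where v: "v \<in> carrier_vec n" "v \<noteq> 0\<^sub>v n" "?L *\<^sub>v v = z \<cdot>\<^sub>v v"
    using ev dim unfolding eigenvalue_def eigenvector_def by auto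
  have Lv: "(\<Sum>j<n. of_real (a i j) * (v $ i - v $ j)) = z * v $ i" if i: "i < n" for i
  proof -
    have "z * v $ i = (?L *\<^sub>v v) $ i" using v i by simp
    also have "\<dots> = (\<Sum>j<n. ?L $$ (i, j) * v $ j)"
      using v(1) i dim by (simp add: scalar_prod_def atLeast0LessThan)
    also have "\<dots> = (\<Sum>j<n. (if i = j then of_real (\<Sum>k<n. a i k) * v $ j else 0) - of_real (a i j) * v $ j)"
      using i by (intro sum.cong) (auto simp: weighted_laplacian_def left_diff_distrib)
    also have "\<dots> = (\<Sum>j<n. of_real (a i j) * v $ i) - (\<Sum>j<n. of_real (a i j) * v $ j)"
      using i by (simp add: sum_subtractf sum_distrib_right)
    also have "\<dots> = (\<Sum>j<n. of_real (a i j) * (v $ i - v $ j))"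
      by (simp add: sum_subtractf right_diff_distrib)
    finally show ?thesis by simp
  qed
  define N where "N = (\<Sum>i<n. (cmod (v $ i))\<^sup>2)"
  define W where "W = (\<Sum>i<n. \<Sum>j<n. a i j * (cmod (v $ i - v $ j))\<^sup>2)"
  have "z * of_real N = (\<Sum>i<n. cnj (v $ i) * (z * v $ i))"
    by (simp add: N_def sum_distrib_left complex_norm_square mult_ac flip: of_real_power)
  also have "\<dots> = (\<Sum>i<n. \<Sum>j<n. of_real (a i j) * cnj (v $ i) * (v $ i - v $ j))" (is "_ = ?S")
    by (simp add: sum_distrib_left mult_ac flip: Lv)
  finally have 1: "z * of_real N = ?S" .
  have "?S = (\<Sum>i<n. \<Sum>j<n. of_real (a i j) * cnj (v $ j) * (v $ j - v $ i))"
    by (subst sum.swap, intro sum.cong) (auto simp: sym)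
  then have "2 * ?S = (\<Sum>i<n. \<Sum>j<n. of_real (a i j) * cnj (v $ i) * (v $ i - v $ j))
      + (\<Sum>i<n. \<Sum>j<n. of_real (a i j) * cnj (v $ j) * (v $ j - v $ i))" by simp
  also have "\<dots> = of_real W"
    by (simp add: W_def complex_norm_square algebra_simps flip: sum.distrib of_real_power)
  finally have 2: "z * of_real (2 * N) = of_real W"
    unfolding 1[symmetric] by (simp add: mult.left_commute)
  obtain i where i: "i < n" "v $ i \<noteq> 0" using v(1,2) by (metis carrier_vecD eq_vecI index_zero_vec)
  have N: "0 < N" unfolding N_def by (rule sum_pos2[of _ i]) (use i in auto)
  have W: "0 \<le> W" unfolding W_def by (intro sum_nonneg mult_nonneg_nonneg) (auto simp: nonneg)
  have "z = of_real (W / (2 * N))" using 2 N by (simp add: field_simps)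
  then show ?thesis using W N by simp
qed

text \<open>
  One factor is split off for the eigenvalue 0 of the all-ones vector; by nonnegativity it is the
  smallest eigenvalue, the one that \<^const>\<open>rho_ss\<close> leaves out.
\<close>

lemma char_poly_weighted_laplacian:
  assumes sym: "\<And>i j. i < n \<Longrightarrow> j < n \<Longrightarrow> a i j = a j i"
    and nonneg: "\<And>i j. i < n \<Longrightarrow> j < n \<Longrightarrow> 0 \<le> a i j"
    and n: "0 < n"
  obtains es where "char_poly (weighted_laplacian n a) = (\<Prod>e\<leftarrow>0 # es. [:- e, 1:])"
    and "length es = n - 1" and "\<forall>e\<in>set es. 0 \<le> e"
proof -
  let ?L = "weighted_laplacian n a"
  let ?C = "map_mat complex_of_real ?L"
  have C: "?C \<in> carrier_mat n n" by simp
  obtain as where as: "char_poly ?C = (\<Prod>e\<leftarrow>as. [:- e, 1:])" "length as = n"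
    using char_poly_factorized[OF C] by blast
  have root: "e = of_real (Re e) \<and> 0 \<le> Re e" if "e \<in> set as" for e
  proof -
    have "poly (char_poly ?C) e = 0" unfolding as(1)
      using that by (auto simp: poly_prod_list prod_list_zero_iff)
    then have "eigenvalue ?C e" using eigenvalue_root_char_poly[OF C] by simp
    then show ?thesis using eigenvalue_weighted_laplacian_nonneg[of n a e] sym nonneg by blast
  qed
  interpret poly: map_poly_inj_idom_hom complex_of_real ..
  have "map_poly complex_of_real (char_poly ?L) = char_poly ?C"
    by (rule of_real_hom.char_poly_hom[symmetric, of _ n]) simp
  also have "\<dots> = (\<Prod>e\<leftarrow>map (of_real \<circ> Re) as. [:- e, 1:])"
    unfolding as(1) using root by (metis (mono_tags, lifting) comp_apply map_idI)
  also have "\<dots> = map_poly complex_of_real (\<Prod>e\<leftarrow>map Re as. [:- e, 1:])"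
    by (simp add: poly.hom_prod_list o_def)
  finally have cp: "char_poly ?L = (\<Prod>e\<leftarrow>map Re as. [:- e, 1:])"
    by (rule poly.injectivity)
  have "eigenvector ?L (vec n (\<lambda>_. 1)) 0"
  proof -
    have "?L *\<^sub>v vec n (\<lambda>_. 1) = 0 \<cdot>\<^sub>v vec n (\<lambda>_. 1)"
      by (rule eq_vecI) (auto simp: weighted_laplacian_def scalar_prod_def atLeast0LessThan sum_subtractf)
    moreover have "vec n (\<lambda>_. 1) \<noteq> (0\<^sub>v n :: real vec)"
      using n by (metis index_vec index_zero_vec(1) zero_neq_one)
    ultimately show ?thesis unfolding eigenvector_def by (simp add: weighted_laplacian_def)
  qed
  then have "poly (char_poly ?L) 0 = 0"
    using eigenvalue_root_char_poly[of ?L n] unfolding eigenvalue_def by auto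
  then have "0 \<in> set (map Re as)"
    unfolding cp by (auto simp: poly_prod_list prod_list_zero_iff)
  then obtain xs ys where xy: "map Re as = xs @ 0 # ys" by (meson split_list)
  show thesis
  proof
    show "char_poly ?L = (\<Prod>e\<leftarrow>0 # (xs @ ys). [:- e, 1:])"
      unfolding cp xy by (simp add: mult_ac)
    show "length (xs @ ys) = n - 1" using arg_cong[OF xy, of length] as(2) by simp
    have "set (xs @ ys) \<subseteq> set (map Re as)" unfolding xy by auto
    then show "\<forall>e\<in>set (xs @ ys). 0 \<le> e" using root by auto
  qed
qed

lemma proots_linear_factors: "proots (\<Prod>e\<leftarrow>es. [:- e, 1:]) = mset (es :: real list)"
proof (induction es)
  case (Cons e es)
  have "(\<Prod>e\<leftarrow>es. [:- e, 1:]) \<noteq> (0 :: real poly)" by (auto simp: prod_list_zero_iff)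
  then show ?case using Cons by (simp add: proots_mult del: mult_pCons_left)
qed simp

lemma rho_ss_eq_sum_inverse:
  assumes "L \<in> carrier_mat n n" and cp: "char_poly L = (\<Prod>e\<leftarrow>0 # es. [:- e, 1:])"
    and len: "length es = n - 1" and nonneg: "\<forall>e\<in>set es. 0 \<le> e" and n: "0 < n"
  shows "rho_ss L = sum_list (map inverse es) / 2"
proof -
  have "sorted_list_of_multiset (proots (char_poly L)) = sort (0 # es)"
    unfolding cp proots_linear_factors by (simp only: sorted_list_of_multiset_mset)
  also have "\<dots> = 0 # sort es"
    using nonneg by (simp add: insort_is_Cons)
  finally have ord: "ordered_eigenvalue L i = (0 # sort es) ! (i - 1)" for i
    by (simp add: ordered_eigenvalue_def)
  have "(\<Sum>i = 2..n. inverse (ordered_eigenvalue L i)) = (\<Sum>k<n - 1. inverse (sort es ! k))"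
    unfolding ord
    by (rule sum.reindex_bij_witness[of _ "\<lambda>k. k + 2" "\<lambda>i. i - 2"])
       (auto simp: nth_Cons' numeral_2_eq_2)
  also have "\<dots> = sum_list (map inverse (sort es))"
    using len by (simp add: sum_list_sum_nth atLeast0LessThan)
  also have "\<dots> = sum_list (map inverse es)"
    by (metis mset_map mset_sort sum_mset_sum_list)
  finally show ?thesis using assms(1) by (simp add: rho_ss_def)
qed

text \<open>
  Of the distances, only symmetry, the zero diagonal and the equation \<open>L D = \<tau> 1\<^sup>T - 2 I\<close> enter.
  Centering on both sides removes the rank-one term, so \<open>- M D M / 2\<close> is a left inverse of \<open>L\<close> up to
  the projection \<open>M\<close>.
\<close>

theorem rho_ss_eq_sum_distances:
  fixes a D :: "nat \<Rightarrow> nat \<Rightarrow> real"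
  assumes n: "0 < n"
    and sym: "\<And>i j. i < n \<Longrightarrow> j < n \<Longrightarrow> a i j = a j i"
    and nonneg: "\<And>i j. i < n \<Longrightarrow> j < n \<Longrightarrow> 0 \<le> a i j"
    and Dsym: "\<And>i j. i < n \<Longrightarrow> j < n \<Longrightarrow> D i j = D j i"
    and D0: "\<And>i. i < n \<Longrightarrow> D i i = 0"
    and LD: "\<And>i j. i < n \<Longrightarrow> j < n \<Longrightarrow>
      (\<Sum>k<n. a i k * (D i j - D k j)) = \<tau> i - (if i = j then 2 else 0)"
  shows "rho_ss (weighted_laplacian n a) = (\<Sum>i<n. \<Sum>j<n. D i j) / (4 * real n)"
proof -
  let ?L = "weighted_laplacian n a"
  obtain es where es: "char_poly ?L = (\<Prod>e\<leftarrow>0 # es. [:- e, 1:])"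
    "length es = n - 1" "\<forall>e\<in>set es. 0 \<le> e"
    using char_poly_weighted_laplacian[of n a] sym nonneg n by metis
  define r where "r i = (\<Sum>j<n. D i j)" for i
  define S where "S = (\<Sum>i<n. r i)"
  (* The entries of - M D M / 2, with the row sums r and the total S of D. *)
  define X where "X = mat n n (\<lambda>(i, j). - (D i j - r i / n - r j / n + S / n\<^sup>2) / 2)"
  have X: "X \<in> carrier_mat n n" by (simp add: X_def)
  have col: "(\<Sum>k<n. ?L $$ (k, j)) = 0" if j: "j < n" for j
  proof -
    have "(\<Sum>k<n. ?L $$ (k, j)) = (\<Sum>k<n. (if k = j then \<Sum>l<n. a k l else 0) - a j k)"
      using j sym by (intro sum.cong) (auto simp: weighted_laplacian_def)
    then show ?thesis using j by (simp add: sum_subtractf)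
  qed
  have DL: "(\<Sum>k<n. D i k * ?L $$ (k, j)) = \<tau> j - (if i = j then 2 else 0)"
    if ij: "i < n" "j < n" for i j
  proof -
    have "(\<Sum>k<n. D i k * ?L $$ (k, j))
      = (\<Sum>k<n. (if k = j then D i k * (\<Sum>l<n. a j l) else 0) - a j k * D k i)"
      using ij sym Dsym by (intro sum.cong) (auto simp: weighted_laplacian_def algebra_simps)
    also have "\<dots> = (\<Sum>k<n. a j k * (D j i - D k i))"
      using ij Dsym[of i j] by (simp add: sum_subtractf sum_distrib_left right_diff_distrib mult.commute)
    finally show ?thesis using LD[OF ij(2,1)] by auto
  qed
  have rL: "(\<Sum>k<n. r k * ?L $$ (k, j)) = real n * \<tau> j - 2" if j: "j < n" for j
  proof -
    have "(\<Sum>k<n. r k * ?L $$ (k, j)) = (\<Sum>k<n. \<Sum>i<n. D i k * ?L $$ (k, j))"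
      unfolding r_def sum_distrib_right using Dsym by (intro sum.cong) auto
    also have "\<dots> = (\<Sum>i<n. \<tau> j - (if i = j then 2 else 0))"
      by (subst sum.swap) (simp add: DL j)
    finally show ?thesis using j by (simp add: sum_subtractf)
  qed
  have "sum_list (map inverse es) = (\<Sum>i<n. X $$ (i, i))"
  proof (rule sum_inverse_eigenvalues_eq_trace[OF _ X n _ _ es(1)])
    show "(\<Sum>k<n. X $$ (i, k)) = 0" if i: "i < n" for i
    proof -
      have "(\<Sum>k<n. X $$ (i, k)) = - ((\<Sum>k<n. D i k) - r i - (\<Sum>k<n. r k) / n + S / n) / 2"
        using i n by (simp add: X_def sum.distrib sum_subtractf sum_negf power2_eq_square
          flip: sum_divide_distrib)
      then show ?thesis by (simp add: r_def[symmetric] S_def[symmetric])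
    qed
    show "X * ?L = mat n n (\<lambda>(i, j). (if i = j then 1 else 0) - 1 / real n)"
    proof (rule eq_matI)
      fix i j assume "i < dim_row (mat n n (\<lambda>(i, j). (if i = j then 1 else 0) - 1 / real n))"
        "j < dim_col (mat n n (\<lambda>(i, j). (if i = j then 1 else 0) - 1 / real n))"
      then have ij: "i < n" "j < n" by auto
      have "(X * ?L) $$ (i, j) = (\<Sum>k<n. X $$ (i, k) * ?L $$ (k, j))"
        using X ij by (intro mult_mat_entry) auto
      also have "\<dots> = (\<Sum>k<n. - (1/2) * (D i k * ?L $$ (k, j))
          + (1 / (2 * n)) * (r k * ?L $$ (k, j)) + (r i / n - S / n\<^sup>2) / 2 * ?L $$ (k, j))"
        using ij n by (intro sum.cong) (auto simp: X_def field_simps)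
      also have "\<dots> = - (1/2) * (\<tau> j - (if i = j then 2 else 0)) + (1 / (2 * n)) * (real n * \<tau> j - 2)"
        unfolding sum.distrib sum_distrib_left[symmetric] DL[OF ij] rL[OF ij(2)] col[OF ij(2)] by simp
      also have "\<dots> = (if i = j then 1 else 0) - 1 / real n"
        using n by (simp add: field_simps)
      finally show "(X * ?L) $$ (i, j) = mat n n (\<lambda>(i, j). (if i = j then 1 else 0) - 1 / real n) $$ (i, j)"
        using ij by simp
    qed (auto simp: X_def weighted_laplacian_def)
  qed simp
  also have "\<dots> = (\<Sum>i<n. r i / n - S / (2 * n\<^sup>2))"
    using D0 n by (intro sum.cong) (auto simp: X_def field_simps)
  also have "\<dots> = S / n - S / (2 * n)"
    using n by (simp add: sum_subtractf power2_eq_square S_def[symmetric] flip: sum_divide_distrib)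
  also have "\<dots> = S / (2 * n)" using n by (simp add: field_simps)
  finally show ?thesis
    using rho_ss_eq_sum_inverse[OF _ es n] n unfolding S_def r_def by simp
qed

section \<open>Tree metrics\<close>

text \<open>
  The tree with nodes \<open>V\<close> and arcs \<open>E\<close>, built by attaching leaves, together with its distance function.
  Only the values of \<open>d\<close> on \<open>V\<close> matter, so the same \<open>d\<close> can serve for all intermediate trees.
\<close>

inductive tree_metric :: "('a \<Rightarrow> 'a \<Rightarrow> nat) \<Rightarrow> 'a set \<Rightarrow> ('a \<times> 'a) set \<Rightarrow> bool"
  for d where
  vertex: "d v v = 0 \<Longrightarrow> tree_metric d {v} {}"
| leaf: "tree_metric d V E \<Longrightarrow> u \<in> V \<Longrightarrow> w \<notin> V \<Longrightarrow> d w w = 0 \<Longrightarrow>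
    (\<And>x. x \<in> V \<Longrightarrow> d w x = Suc (d u x)) \<Longrightarrow> (\<And>x. x \<in> V \<Longrightarrow> d x w = Suc (d x u)) \<Longrightarrow>
    tree_metric d (insert w V) (insert (u, w) (insert (w, u) E))"

lemma tree_metric_cong:
  assumes "tree_metric d V E" "\<And>x y. x \<in> V \<Longrightarrow> y \<in> V \<Longrightarrow> d' x y = d x y"
  shows "tree_metric d' V E"
  using assms
proof (induction rule: tree_metric.induct)
  case (leaf V E u w)
  show ?case by (rule tree_metric.leaf) (use leaf in auto)
qed (auto intro: tree_metric.vertex)

lemma tree_metric_finite: "tree_metric d V E \<Longrightarrow> finite V"
  by (induction rule: tree_metric.induct) auto

lemma tree_metric_nonempty: "tree_metric d V E \<Longrightarrow> V \<noteq> {}"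
  by (induction rule: tree_metric.induct) auto

lemma tree_metric_edges_subset: "tree_metric d V E \<Longrightarrow> E \<subseteq> V \<times> V"
  by (induction rule: tree_metric.induct) auto

lemma tree_metric_refl: "tree_metric d V E \<Longrightarrow> x \<in> V \<Longrightarrow> d x x = 0"
  by (induction rule: tree_metric.induct) auto

lemma tree_metric_pos: "tree_metric d V E \<Longrightarrow> x \<in> V \<Longrightarrow> y \<in> V \<Longrightarrow> x \<noteq> y \<Longrightarrow> 0 < d x y"
  by (induction arbitrary: x y rule: tree_metric.induct) auto

lemma tree_metric_sym: "tree_metric d V E \<Longrightarrow> x \<in> V \<Longrightarrow> y \<in> V \<Longrightarrow> d x y = d y x"
  by (induction arbitrary: x y rule: tree_metric.induct) auto

lemma tree_metric_edge_iff:
  "tree_metric d V E \<Longrightarrow> x \<in> V \<Longrightarrow> y \<in> V \<Longrightarrow> (x, y) \<in> E \<longleftrightarrow> d x y = 1"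
proof (induction arbitrary: x y rule: tree_metric.induct)
  case (leaf V E u w)
  have "E \<subseteq> V \<times> V" by (rule tree_metric_edges_subset[OF leaf.hyps(1)])
  then have wE: "(w, x) \<notin> E" "(x, w) \<notin> E" for x using \<open>w \<notin> V\<close> by auto
  have zero: "d x u = 0 \<longleftrightarrow> x = u" "d u x = 0 \<longleftrightarrow> x = u" if "x \<in> V" for x
    using that tree_metric_refl[OF leaf.hyps(1)] tree_metric_pos[OF leaf.hyps(1)] \<open>u \<in> V\<close>
    by (metis less_irrefl)+
  show ?case using leaf.prems leaf.hyps wE zero leaf.IH[of x y] by auto
qed auto

text \<open>
  Trees are bipartite: adjacent nodes never have the same distance from a third one. The bound by one
  on the difference also serves as the triangle inequality along an edge.
\<close>

lemma tree_metric_adjacent_differ: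
  "tree_metric d V E \<Longrightarrow> (x, y) \<in> E \<Longrightarrow> z \<in> V \<Longrightarrow> d x z = Suc (d y z) \<or> d y z = Suc (d x z)"
proof (induction arbitrary: x y z rule: tree_metric.induct)
  case (leaf V E u w)
  have sub: "E \<subseteq> V \<times> V" and duu: "d u u = 0"
    using tree_metric_edges_subset[OF leaf.hyps(1)] tree_metric_refl[OF leaf.hyps(1,2)] by auto
  consider "(x, y) = (u, w)" | "(x, y) = (w, u)" | "(x, y) \<in> E" using leaf.prems by auto
  then show ?case
  proof cases
    case 3
    then have "x \<in> V" "y \<in> V" using sub by auto
    then show ?thesis using leaf.IH[OF 3, of z] leaf.IH[OF 3 \<open>u \<in> V\<close>] leaf.hyps leaf.prems by auto
  qed (use leaf.hyps leaf.prems duu in auto)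
qed auto

text \<open>
  The distance dominates every 1-Lipschitz function. Applied to a numbering of the nodes along a path
  it bounds the distances in that path from below.
\<close>

lemma tree_metric_lipschitz_le:
  fixes f :: "'a \<Rightarrow> int"
  shows "tree_metric d V E \<Longrightarrow> (\<And>x y. (x, y) \<in> E \<Longrightarrow> \<bar>f x - f y\<bar> \<le> 1) \<Longrightarrow> x \<in> V \<Longrightarrow> y \<in> V
    \<Longrightarrow> \<bar>f x - f y\<bar> \<le> int (d x y)"
proof (induction arbitrary: x y rule: tree_metric.induct)
  case (leaf V E u w)
  have IH: "\<bar>f x - f y\<bar> \<le> int (d x y)" if "x \<in> V" "y \<in> V" for x y
    using leaf.IH[of x y] leaf.prems(1) that by blast
  have wu: "\<bar>f w - f u\<bar> \<le> 1" using leaf.prems(1)[of w u] by simp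
  consider "x = w" "y = w" | "x = w" "y \<in> V" | "x \<in> V" "y = w" | "x \<in> V" "y \<in> V"
    using leaf.prems by auto
  then show ?case
  proof cases
    case 2
    then show ?thesis using IH[of u y] wu leaf.hyps by simp
  next
    case 3
    then show ?thesis using IH[of x u] wu leaf.hyps by simp
  qed (use IH in auto)
qed auto

lemma tree_metric_path:
  "tree_metric d V E \<Longrightarrow> x \<in> V \<Longrightarrow> y \<in> V \<Longrightarrow>
    \<exists>xs. xs \<noteq> [] \<and> hd xs = x \<and> last xs = y \<and> distinct xs \<and> set xs \<subseteq> V
       \<and> successively (\<lambda>a b. (a, b) \<in> E) xs"
proof (induction arbitrary: x y rule: tree_metric.induct)
  case (vertex v)
  then show ?case by (intro exI[of _ "[v]"]) auto
next
  case (leaf V E u w)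
  let ?E = "insert (u, w) (insert (w, u) E)"
  have IH: "\<exists>xs. xs \<noteq> [] \<and> hd xs = x \<and> last xs = y \<and> distinct xs \<and> set xs \<subseteq> V
      \<and> successively (\<lambda>a b. (a, b) \<in> ?E) xs" if xy: "x \<in> V" "y \<in> V" for x y
  proof -
    obtain xs where xs: "xs \<noteq> []" "hd xs = x" "last xs = y" "distinct xs" "set xs \<subseteq> V"
      "successively (\<lambda>a b. (a, b) \<in> E) xs" using leaf.IH[OF xy] by blast
    have "successively (\<lambda>a b. (a, b) \<in> ?E) xs"
      using xs(6) by (rule successively_mono) auto
    with xs show ?thesis by blast
  qed
  consider "x = w" "y = w" | "x = w" "y \<in> V" | "x \<in> V" "y = w" | "x \<in> V" "y \<in> V"
    using leaf.prems by auto
  then show ?case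
  proof cases
    case 1
    then show ?thesis by (intro exI[of _ "[w]"]) auto
  next
    case 2
    obtain xs where xs: "xs \<noteq> []" "hd xs = u" "last xs = y" "distinct xs" "set xs \<subseteq> V"
      "successively (\<lambda>a b. (a, b) \<in> ?E) xs" using IH[OF \<open>u \<in> V\<close> 2(2)] by blast
    have "successively (\<lambda>a b. (a, b) \<in> ?E) (w # xs)"
      unfolding successively_Cons using xs(2,6) by blast
    with xs show ?thesis using 2 \<open>w \<notin> V\<close> by (intro exI[of _ "w # xs"]) auto
  next
    case 3
    obtain xs where xs: "xs \<noteq> []" "hd xs = x" "last xs = u" "distinct xs" "set xs \<subseteq> V"
      "successively (\<lambda>a b. (a, b) \<in> ?E) xs" using IH[OF 3(1) \<open>u \<in> V\<close>] by blast
    have "successively (\<lambda>a b. (a, b) \<in> ?E) (xs @ [w])"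
      unfolding successively_append_iff using xs(3,6) by simp
    with xs show ?thesis using 3 \<open>w \<notin> V\<close> by (intro exI[of _ "xs @ [w]"]) auto
  next
    case 4
    from IH[OF this] show ?thesis by blast
  qed
qed

text \<open>
  This is \<open>L D = \<tau> 1\<^sup>T - 2 I\<close> entrywise. When a leaf \<open>w\<close> is attached at \<open>u\<close>, row \<open>u\<close> of the left side
  gains the term \<open>-1\<close> in the old columns, which is compensated by the increased degree of \<open>u\<close>. Old rows
  of column \<open>w\<close> reduce to column \<open>u\<close>, because the distances differ by the constant 1.
\<close>

lemma tree_metric_laplace:
  "tree_metric d V E \<Longrightarrow> x \<in> V \<Longrightarrow> z \<in> V \<Longrightarrow>
    (\<Sum>y\<in>V. of_bool ((x, y) \<in> E) * (real (d x z) - real (d y z)))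
    = 2 - (\<Sum>y\<in>V. of_bool ((x, y) \<in> E)) - (if x = z then 2 else 0)"
proof (induction arbitrary: x z rule: tree_metric.induct)
  case (leaf V E u w)
  let ?E = "insert (u, w) (insert (w, u) E)"
  have fin: "finite V" and sub: "E \<subseteq> V \<times> V" and duu: "d u u = 0"
    using tree_metric_finite[OF leaf.hyps(1)] tree_metric_edges_subset[OF leaf.hyps(1)]
      tree_metric_refl[OF leaf.hyps(1,2)] by auto
  have wE: "(w, x) \<notin> E" "(x, w) \<notin> E" for x using sub \<open>w \<notin> V\<close> by auto
  (* A sum over the neighbours of the new leaf has one term; for old nodes only u gains one. *)
  have Vw: "(\<Sum>y\<in>V. of_bool ((w, y) \<in> ?E) * g y) = (g u :: real)" for g
    using wE \<open>u \<in> V\<close> \<open>w \<notin> V\<close> fin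
    by (subst sum.remove[of _ u]) (auto intro!: sum.neutral)
  have Vx: "(\<Sum>y\<in>V. of_bool ((x, y) \<in> ?E) * g y) = (\<Sum>y\<in>V. of_bool ((x, y) \<in> E) * (g y :: real))"
    if "x \<in> V" for x g
  proof (rule sum.cong)
    fix y assume "y \<in> V"
    then have "(x, y) \<in> ?E \<longleftrightarrow> (x, y) \<in> E" using that \<open>w \<notin> V\<close> by auto
    then show "of_bool ((x, y) \<in> ?E) * g y = of_bool ((x, y) \<in> E) * g y" by (simp only:)
  qed simp
  have xw: "(x, w) \<in> ?E \<longleftrightarrow> x = u" for x using sub \<open>u \<in> V\<close> \<open>w \<notin> V\<close> by auto
  have ww: "(w, w) \<notin> ?E" using sub \<open>u \<in> V\<close> \<open>w \<notin> V\<close> by auto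
  have deg: "(\<Sum>y\<in>insert w V. of_bool ((x, y) \<in> ?E) :: real)
     = (if x = w then 1 else of_bool (x = u) + (\<Sum>y\<in>V. of_bool ((x, y) \<in> E)))"
    if x: "x \<in> insert w V"
  proof (cases "x = w")
    case True
    then show ?thesis using Vw[of "\<lambda>_. 1"] ww fin \<open>w \<notin> V\<close> by (simp del: insert_iff)
  next
    case False
    then have "x \<in> V" using x by simp
    from False show ?thesis
      using Vx[OF \<open>x \<in> V\<close>, of "\<lambda>_. 1"]
      by (simp only: sum.insert[OF fin \<open>w \<notin> V\<close>] xw mult_1_right if_False)
  qed
  have lap: "(\<Sum>y\<in>insert w V. of_bool ((x, y) \<in> ?E) * (real (d x z) - real (d y z)))
     = (if x = w then real (d w z) - real (d u z)
        else of_bool (x = u) * (real (d x z) - real (d w z))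
          + (\<Sum>y\<in>V. of_bool ((x, y) \<in> E) * (real (d x z) - real (d y z))))"
    if x: "x \<in> insert w V"
  proof (cases "x = w")
    case True
    then show ?thesis
      using Vw[of "\<lambda>y. real (d x z) - real (d y z)"] ww fin \<open>w \<notin> V\<close> by (simp del: insert_iff)
  next
    case False
    then have "x \<in> V" using x by simp
    from False show ?thesis
      using Vx[OF \<open>x \<in> V\<close>, of "\<lambda>y. real (d x z) - real (d y z)"]
      by (simp only: sum.insert[OF fin \<open>w \<notin> V\<close>] xw if_False)
  qed
  consider "x = w" "z = w" | "x = w" "z \<in> V" | "x \<in> V" "z = w" | "x \<in> V" "z \<in> V"
    using leaf.prems by auto
  then show ?case
  proof cases
    case 1
    then show ?thesis unfolding deg[OF leaf.prems(1)] lap[OF leaf.prems(1)] using leaf.hyps duu by simp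
  next
    case 2
    then show ?thesis unfolding deg[OF leaf.prems(1)] lap[OF leaf.prems(1)] using leaf.hyps by auto
  next
    case 3
    have "(\<Sum>y\<in>V. of_bool ((x, y) \<in> E) * (real (d x w) - real (d y w)))
      = (\<Sum>y\<in>V. of_bool ((x, y) \<in> E) * (real (d x u) - real (d y u)))"
      using 3 leaf.hyps by (intro sum.cong) auto
    then show ?thesis unfolding deg[OF leaf.prems(1)] lap[OF leaf.prems(1)]
      using 3 leaf.hyps leaf.IH[OF 3(1) \<open>u \<in> V\<close>] duu
      by (cases "x = u") auto
  next
    case 4
    then have "x \<noteq> w" using \<open>w \<notin> V\<close> by auto
    then show ?thesis unfolding deg[OF leaf.prems(1)] lap[OF leaf.prems(1)]
      using leaf.IH[OF 4] leaf.hyps(5)[OF 4(2)] by (cases "x = u") simp_all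
  qed
qed auto

section \<open>Extremal distance sums in trees\<close>

lemma tree_metric_sum_insert:
  fixes d :: "'a \<Rightarrow> 'a \<Rightarrow> nat"
  assumes "finite V" "w \<notin> V" "d w w = 0" "\<And>x. x \<in> V \<Longrightarrow> d w x = Suc (d u x)"
  shows "(\<Sum>y\<in>insert w V. d w y) = (\<Sum>y\<in>V. d u y) + card V"
  using assms by (simp add: sum_Suc)

lemma tree_metric_less_card: "tree_metric d V E \<Longrightarrow> x \<in> V \<Longrightarrow> y \<in> V \<Longrightarrow> d x y < card V"
proof (induction arbitrary: x y rule: tree_metric.induct)
  case (leaf V E u w)
  have "finite V" by (rule tree_metric_finite[OF leaf.hyps(1)])
  with leaf show ?case by (force intro: less_SucI)
qed auto

text \<open>
  If the first node is the new leaf \<open>w\<close>, all distances from \<open>u\<close> grow by 1; otherwise a single term, of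
  less than the number of nodes, is added. Either way the sum grows by at most the number of old nodes.
\<close>

lemma tree_metric_transmission_le:
  "tree_metric d V E \<Longrightarrow> x \<in> V \<Longrightarrow> 2 * (\<Sum>y\<in>V. d x y) \<le> card V * (card V - 1)"
proof (induction arbitrary: x rule: tree_metric.induct)
  case (leaf V E u w)
  have fin: "finite V" by (rule tree_metric_finite[OF leaf.hyps(1)])
  then have card: "card V > 0" using \<open>u \<in> V\<close> by (auto simp: card_gt_0_iff)
  obtain m where m: "card V = Suc m" using card by (auto simp: gr0_conv_Suc)
  show ?case
  proof (cases "x = w")
    case True
    then show ?thesis
      using leaf.IH[OF \<open>u \<in> V\<close>] tree_metric_sum_insert[of V w d u] leaf.hyps fin m
      by (simp add: algebra_simps)
  next
    case False
    then have x: "x \<in> V" using leaf.prems by auto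
    have "d x u < card V" by (rule tree_metric_less_card[OF leaf.hyps(1) x leaf.hyps(2)])
    then show ?thesis
      using leaf.IH[OF x] x leaf.hyps fin m by (simp add: algebra_simps)
  qed
qed auto

text \<open>
  The distance from an extremal node \<open>x\<close> itself numbers the nodes along the path. Equality persists
  in the smaller tree: either \<open>x\<close> is the new leaf and \<open>u\<close> is extremal, or \<open>x\<close> stays extremal and \<open>u\<close> has
  the maximal distance \<open>m\<close> from it, so that the leaf prolongs the path at its other end.
\<close>

lemma tree_metric_path_if_transmission_max:
  "tree_metric d V E \<Longrightarrow> x \<in> V \<Longrightarrow> 2 * (\<Sum>y\<in>V. d x y) = card V * (card V - 1) \<Longrightarrow>
    inj_on (d x) V \<and> (\<forall>y\<in>V. \<forall>z\<in>V. (y, z) \<in> E \<longleftrightarrow> d x y = Suc (d x z) \<or> d x z = Suc (d x y))"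
proof (induction arbitrary: x rule: tree_metric.induct)
  case (vertex v)
  then have "x = v" by simp
  then show ?case using vertex.hyps by simp
next
  case (leaf V E u w)
  have fin: "finite V" by (rule tree_metric_finite[OF leaf.hyps(1)])
  have sub: "E \<subseteq> V \<times> V" by (rule tree_metric_edges_subset[OF leaf.hyps(1)])
  have duu: "d u u = 0" by (rule tree_metric_refl[OF leaf.hyps(1,2)])
  have card: "card V > 0" using \<open>u \<in> V\<close> fin by (auto simp: card_gt_0_iff)
  obtain m where m: "card V = Suc m" using card by (auto simp: gr0_conv_Suc)
  show ?case
  proof (cases "x = w")
    case True
    have "2 * (\<Sum>y\<in>V. d u y) = card V * (card V - 1)"
      using leaf.prems(2) tree_metric_sum_insert[of V w d u] leaf.hyps fin m True
      by (simp add: algebra_simps)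
    note IH = leaf.IH[OF \<open>u \<in> V\<close> this]
    have 0: "d u y = 0 \<longleftrightarrow> y = u" if "y \<in> V" for y
      using that IH \<open>u \<in> V\<close> duu by (metis inj_onD)
    have inj: "inj_on (d w) (insert w V)"
      using IH leaf.hyps by (auto simp: inj_on_def)
    have iff: "(y, z) \<in> insert (u, w) (insert (w, u) E) \<longleftrightarrow> d w y = Suc (d w z) \<or> d w z = Suc (d w y)"
      if "y \<in> insert w V" "z \<in> insert w V" for y z
      using that sub IH leaf.hyps 0 by auto
    show ?thesis unfolding True by (intro conjI ballI inj iff)
  next
    case False
    then have x: "x \<in> V" using leaf.prems by auto
    have lt: "d x y < card V" if "y \<in> V" for y
      by (rule tree_metric_less_card[OF leaf.hyps(1) x that])
    have le: "2 * (\<Sum>y\<in>V. d x y) \<le> card V * (card V - 1)"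
      by (rule tree_metric_transmission_le[OF leaf.hyps(1) x])
    have eq: "2 * (\<Sum>y\<in>V. d x y) + 2 * Suc (d x u) = Suc m * Suc m + Suc m"
      using leaf.prems(2) x leaf.hyps fin m by simp
    have "2 * (\<Sum>y\<in>V. d x y) = card V * (card V - 1)" and dxu: "d x u = m"
      using eq le lt[OF \<open>u \<in> V\<close>] m by (auto simp: algebra_simps)
    note IH = leaf.IH[OF x this(1)]
    have top: "d x y = m \<longleftrightarrow> y = u" if "y \<in> V" for y
      using that IH \<open>u \<in> V\<close> dxu by (metis inj_onD)
    have dxw: "d x w = Suc m" using leaf.hyps x dxu by simp
    have lt': "d x y < Suc m" if "y \<in> V" for y using lt that m by simp
    have "d x w \<notin> d x ` V"
    proof
      assume "d x w \<in> d x ` V"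
      then obtain y where "y \<in> V" "d x w = d x y" by blast
      then show False using dxw lt'[of y] by simp
    qed
    then have inj: "inj_on (d x) (insert w V)"
      using IH unfolding inj_on_insert by blast
    have iff: "(y, z) \<in> insert (u, w) (insert (w, u) E) \<longleftrightarrow> d x y = Suc (d x z) \<or> d x z = Suc (d x y)"
      if yz: "y \<in> insert w V" "z \<in> insert w V" for y z
    proof -
      have wE: "(w, v) \<notin> E" "(v, w) \<notin> E" for v using sub \<open>w \<notin> V\<close> by auto
      have wu: "w \<noteq> u" using \<open>u \<in> V\<close> \<open>w \<notin> V\<close> by auto
      consider "y = w" "z = w" | "y = w" "z \<in> V" "z \<noteq> w" | "z = w" "y \<in> V" "y \<noteq> w"
        | "y \<in> V" "z \<in> V" "y \<noteq> w" "z \<noteq> w"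
        using yz \<open>w \<notin> V\<close> by auto
      then show ?thesis
      proof cases
        case 1
        then show ?thesis using wE wu by simp
      next
        case 2
        have "(w, z) \<in> insert (u, w) (insert (w, u) E) \<longleftrightarrow> z = u" using wE wu by auto
        moreover have "d x w = Suc (d x z) \<longleftrightarrow> z = u"
          unfolding dxw top[OF 2(2), symmetric] by auto
        moreover have "d x z \<noteq> Suc (d x w)" using lt'[OF 2(2)] dxw by simp
        ultimately show ?thesis unfolding 2(1) by (simp only: simp_thms)
      next
        case 3
        have "(y, w) \<in> insert (u, w) (insert (w, u) E) \<longleftrightarrow> y = u" using wE wu by auto
        moreover have "d x w = Suc (d x y) \<longleftrightarrow> y = u"
          unfolding dxw top[OF 3(2), symmetric] by auto
        moreover have "d x y \<noteq> Suc (d x w)" using lt'[OF 3(2)] dxw by simp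
        ultimately show ?thesis unfolding 3(1) by (simp only: simp_thms)
      next
        case 4
        then show ?thesis using IH by simp
      qed
    qed
    show ?thesis by (intro conjI ballI inj iff)
  qed
qed

lemma sum_insert_square:
  fixes g :: "'a \<Rightarrow> 'a \<Rightarrow> nat"
  assumes "finite V" "w \<notin> V"
  shows "(\<Sum>x\<in>insert w V. \<Sum>y\<in>insert w V. g x y)
    = g w w + (\<Sum>y\<in>V. g w y) + (\<Sum>x\<in>V. g x w) + (\<Sum>x\<in>V. \<Sum>y\<in>V. g x y)"
  unfolding sum.insert[OF assms] sum.distrib by simp

lemma tree_metric_total_insert:
  assumes "tree_metric d V E" "u \<in> V" "w \<notin> V" "d w w = 0"
    "\<And>x. x \<in> V \<Longrightarrow> d w x = Suc (d u x)" "\<And>x. x \<in> V \<Longrightarrow> d x w = Suc (d x u)"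
  shows "(\<Sum>x\<in>insert w V. \<Sum>y\<in>insert w V. d x y)
    = (\<Sum>x\<in>V. \<Sum>y\<in>V. d x y) + 2 * ((\<Sum>y\<in>V. d u y) + card V)"
proof -
  have fin: "finite V" by (rule tree_metric_finite[OF assms(1)])
  have "(\<Sum>x\<in>V. d x w) = (\<Sum>x\<in>V. Suc (d u x))"
  proof (rule sum.cong)
    fix x assume "x \<in> V"
    then show "d x w = Suc (d u x)"
      using assms(6)[of x] tree_metric_sym[OF assms(1) \<open>x \<in> V\<close> assms(2)] by simp
  qed simp
  moreover have "(\<Sum>x\<in>V. d w x) = (\<Sum>x\<in>V. Suc (d u x))"
    by (rule sum.cong) (simp_all add: assms(5))
  moreover have "(\<Sum>x\<in>V. Suc (d u x)) = (\<Sum>x\<in>V. d u x) + card V"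
    by (simp add: sum_Suc)
  ultimately show ?thesis
    unfolding sum_insert_square[OF fin assms(3)] assms(4) by simp
qed

lemma tree_metric_total_le:
  "tree_metric d V E \<Longrightarrow> 3 * (\<Sum>x\<in>V. \<Sum>y\<in>V. d x y) + card V \<le> card V ^ 3"
proof (induction rule: tree_metric.induct)
  case (leaf V E u w)
  have fin: "finite V" by (rule tree_metric_finite[OF leaf.hyps(1)])
  have card: "card V > 0" using \<open>u \<in> V\<close> fin by (auto simp: card_gt_0_iff)
  obtain m where m: "card V = Suc m" using card by (auto simp: gr0_conv_Suc)
  have t: "2 * (\<Sum>y\<in>V. d u y) \<le> card V * (card V - 1)"
    by (rule tree_metric_transmission_le[OF leaf.hyps(1,2)])
  have total: "(\<Sum>x\<in>insert w V. \<Sum>y\<in>insert w V. d x y)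
      = (\<Sum>x\<in>V. \<Sum>y\<in>V. d x y) + 2 * ((\<Sum>y\<in>V. d u y) + card V)"
    using leaf.hyps by (rule tree_metric_total_insert)
  have "card (insert w V) = Suc (Suc m)" using fin \<open>w \<notin> V\<close> m by simp
  then show ?case
    using leaf.IH t unfolding total m by (simp add: power3_eq_cube algebra_simps)
qed auto

text \<open>
  The witness is the last leaf attached: the bounds for the smaller tree and for the distance sum
  of its attachment point must both be tight.
\<close>

lemma tree_metric_total_max_imp_transmission_max:
  "tree_metric d V E \<Longrightarrow> 3 * (\<Sum>x\<in>V. \<Sum>y\<in>V. d x y) + card V = card V ^ 3 \<Longrightarrow>
    \<exists>x\<in>V. 2 * (\<Sum>y\<in>V. d x y) = card V * (card V - 1)"
proof (cases rule: tree_metric.cases[of d V E, case_names _ vertex leaf])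
  case (leaf U F u w)
  have fin: "finite U" using tree_metric_finite[OF \<open>tree_metric d U F\<close>] .
  have card: "card U > 0" using \<open>u \<in> U\<close> fin by (auto simp: card_gt_0_iff)
  obtain m where m: "card U = Suc m" using card by (auto simp: gr0_conv_Suc)
  assume max: "3 * (\<Sum>x\<in>V. \<Sum>y\<in>V. d x y) + card V = card V ^ 3"
  have t: "2 * (\<Sum>y\<in>U. d u y) \<le> card U * (card U - 1)"
    using tree_metric_transmission_le[OF \<open>tree_metric d U F\<close> \<open>u \<in> U\<close>] .
  have s: "3 * (\<Sum>x\<in>U. \<Sum>y\<in>U. d x y) + card U \<le> card U ^ 3"
    using tree_metric_total_le[OF \<open>tree_metric d U F\<close>] .
  have V: "V = insert w U" by fact
  have total: "(\<Sum>x\<in>V. \<Sum>y\<in>V. d x y)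
      = (\<Sum>x\<in>U. \<Sum>y\<in>U. d x y) + 2 * ((\<Sum>y\<in>U. d u y) + card U)"
    unfolding V by (rule tree_metric_total_insert) (use leaf in auto)
  have cardV: "card V = Suc (Suc m)" using fin \<open>w \<notin> U\<close> m V by simp
  have "2 * (\<Sum>y\<in>U. d u y) = card U * (card U - 1)"
    using max s t unfolding total cardV m by (simp add: power3_eq_cube algebra_simps)
  moreover have "(\<Sum>y\<in>V. d w y) = (\<Sum>y\<in>U. d u y) + card U"
    unfolding V by (rule tree_metric_sum_insert) (use leaf fin in auto)
  ultimately have "2 * (\<Sum>y\<in>V. d w y) = card V * (card V - 1)"
    using m cardV by (simp add: algebra_simps)
  then show ?thesis unfolding V by blast
qed auto

lemma tree_metric_degree_sum:
  "tree_metric d V E \<Longrightarrow> (\<Sum>x\<in>V. \<Sum>y\<in>V. of_bool ((x, y) \<in> E)) + 2 = 2 * card V"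
proof (induction rule: tree_metric.induct)
  case (leaf V E u w)
  let ?E = "insert (u, w) (insert (w, u) E)"
  have fin: "finite V" and sub: "E \<subseteq> V \<times> V"
    using tree_metric_finite[OF leaf.hyps(1)] tree_metric_edges_subset[OF leaf.hyps(1)] by auto
  have mem: "(x, y) \<in> ?E \<longleftrightarrow> (x, y) \<in> E" "(w, y) \<in> ?E \<longleftrightarrow> y = u" "(x, w) \<in> ?E \<longleftrightarrow> x = u"
    if "x \<in> V" "y \<in> V" for x y
    using that sub \<open>u \<in> V\<close> \<open>w \<notin> V\<close> by auto
  have one: "(\<Sum>y\<in>V. of_bool (y = u)) = (1 :: nat)"
    using fin \<open>u \<in> V\<close> by (simp add: of_bool_def)
  have "(\<Sum>x\<in>V. \<Sum>y\<in>V. of_bool ((x, y) \<in> ?E)) = (\<Sum>x\<in>V. \<Sum>y\<in>V. of_bool ((x, y) \<in> E) :: nat)"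
    by (intro sum.cong refl arg_cong[of _ _ of_bool] mem(1))
  moreover have "(\<Sum>y\<in>V. of_bool ((w, y) \<in> ?E)) = (\<Sum>y\<in>V. of_bool (y = u) :: nat)"
    using \<open>u \<in> V\<close> by (intro sum.cong refl arg_cong[of _ _ of_bool] mem(2))
  moreover have "(\<Sum>x\<in>V. of_bool ((x, w) \<in> ?E)) = (\<Sum>x\<in>V. of_bool (x = u) :: nat)"
    using \<open>u \<in> V\<close> by (intro sum.cong refl arg_cong[of _ _ of_bool] mem(3))
  moreover have "(w, w) \<notin> ?E" using sub \<open>u \<in> V\<close> \<open>w \<notin> V\<close> by auto
  ultimately have "(\<Sum>x\<in>insert w V. \<Sum>y\<in>insert w V. of_bool ((x, y) \<in> ?E))
      = 1 + 1 + (\<Sum>x\<in>V. \<Sum>y\<in>V. of_bool ((x, y) \<in> E) :: nat)"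
    unfolding sum_insert_square[OF fin \<open>w \<notin> V\<close>] one by (simp only: of_bool_eq add_0_left)
  moreover have "card (insert w V) = Suc (card V)" using fin \<open>w \<notin> V\<close> by simp
  ultimately show ?case using leaf.IH by (simp only: mult_Suc_right add_ac)
qed auto

text \<open>
  Adding 1 for adjacent and 2 for equal nodes turns every distance into a number that is at least 2;
  the number of arcs is known, so the total of these additions is too.
\<close>

lemma tree_metric_total_ge:
  assumes T: "tree_metric d V E"
  shows "2 * (card V)\<^sup>2 + 2 \<le> (\<Sum>x\<in>V. \<Sum>y\<in>V. d x y) + 4 * card V"
    and "(\<Sum>x\<in>V. \<Sum>y\<in>V. d x y) + 4 * card V = 2 * (card V)\<^sup>2 + 2 \<longleftrightarrow>
      (\<forall>x\<in>V. \<forall>y\<in>V. x \<noteq> y \<longrightarrow> (x, y) \<notin> E \<longrightarrow> d x y = 2)"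
proof -
  have fin: "finite V" by (rule tree_metric_finite[OF T])
  define g where "g x y = d x y + of_bool ((x, y) \<in> E) + (if x = y then 2 else 0)" for x y
  have g: "g x y = (if x \<noteq> y \<and> (x, y) \<notin> E then d x y else 2) \<and> 2 \<le> g x y"
    if "x \<in> V" "y \<in> V" for x y
    using tree_metric_edge_iff[OF T that] tree_metric_refl[OF T that(1)] tree_metric_pos[OF T that]
    by (cases "x = y"; cases "(x, y) \<in> E") (auto simp: g_def)
  have g2: "2 \<le> g (fst p) (snd p)" if "p \<in> V \<times> V" for p
    using g[of "fst p" "snd p"] that by (auto simp: mem_Times_iff)
  have "(\<Sum>x\<in>V. \<Sum>y\<in>V. g x y) = (\<Sum>x\<in>V. \<Sum>y\<in>V. d x y)
      + (\<Sum>x\<in>V. \<Sum>y\<in>V. of_bool ((x, y) \<in> E)) + (\<Sum>x\<in>V. \<Sum>y\<in>V. if x = y then 2 else 0)"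
    by (simp only: g_def sum.distrib)
  moreover have "(\<Sum>x\<in>V. \<Sum>y\<in>V. if x = y then 2 else (0 :: nat)) = 2 * card V"
    using fin by simp
  ultimately have sum_g: "(\<Sum>x\<in>V. \<Sum>y\<in>V. g x y) + 2 = (\<Sum>x\<in>V. \<Sum>y\<in>V. d x y) + 4 * card V"
    using tree_metric_degree_sum[OF T] by linarith
  have two: "(\<Sum>p\<in>V \<times> V. 2) = 2 * (card V)\<^sup>2"
    by (simp add: card_cartesian_product power2_eq_square)
  have pairs: "(\<Sum>x\<in>V. \<Sum>y\<in>V. g x y) = (\<Sum>p\<in>V \<times> V. g (fst p) (snd p))"
    by (simp add: sum.cartesian_product case_prod_beta)
  have le: "2 * (card V)\<^sup>2 \<le> (\<Sum>p\<in>V \<times> V. g (fst p) (snd p))"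
    unfolding two[symmetric] by (intro sum_mono g2)
  then show "2 * (card V)\<^sup>2 + 2 \<le> (\<Sum>x\<in>V. \<Sum>y\<in>V. d x y) + 4 * card V"
    using sum_g pairs by linarith
  have "(\<Sum>p\<in>V \<times> V. g (fst p) (snd p)) = 2 * (card V)\<^sup>2 \<longleftrightarrow> (\<forall>p\<in>V \<times> V. g (fst p) (snd p) = 2)"
  proof
    assume eq: "(\<Sum>p\<in>V \<times> V. g (fst p) (snd p)) = 2 * (card V)\<^sup>2"
    show "\<forall>p\<in>V \<times> V. g (fst p) (snd p) = 2"
    proof (rule ccontr)
      assume "\<not> ?thesis"
      then obtain p where p: "p \<in> V \<times> V" "g (fst p) (snd p) \<noteq> 2" by blast
      then have "2 < g (fst p) (snd p)" using g2[OF p(1)] by simp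
      then have "(\<Sum>p\<in>V \<times> V. 2) < (\<Sum>p\<in>V \<times> V. g (fst p) (snd p))"
        using fin g2 p(1) by (intro sum_strict_mono_ex1) blast+
      then show False using eq two by simp
    qed
  next
    assume "\<forall>p\<in>V \<times> V. g (fst p) (snd p) = 2"
    then have "(\<Sum>p\<in>V \<times> V. g (fst p) (snd p)) = (\<Sum>p\<in>V \<times> V. 2)" by (intro sum.cong) auto
    then show "(\<Sum>p\<in>V \<times> V. g (fst p) (snd p)) = 2 * (card V)\<^sup>2" using two by simp
  qed
  also have "\<dots> \<longleftrightarrow> (\<forall>x\<in>V. \<forall>y\<in>V. x \<noteq> y \<longrightarrow> (x, y) \<notin> E \<longrightarrow> d x y = 2)"
  proof (intro iffI ballI impI)
    fix x y assume "\<forall>p\<in>V \<times> V. g (fst p) (snd p) = 2" and xy: "x \<in> V" "y \<in> V" "x \<noteq> y" "(x, y) \<notin> E"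
    then have "g x y = 2" by (metis SigmaI fst_conv snd_conv)
    then show "d x y = 2" using g[OF xy(1,2)] xy by simp
  next
    fix p assume "\<forall>x\<in>V. \<forall>y\<in>V. x \<noteq> y \<longrightarrow> (x, y) \<notin> E \<longrightarrow> d x y = 2" "p \<in> V \<times> V"
    then show "g (fst p) (snd p) = 2" using g[of "fst p" "snd p"] by (auto simp: mem_Times_iff)
  qed
  finally show "(\<Sum>x\<in>V. \<Sum>y\<in>V. d x y) + 4 * card V = 2 * (card V)\<^sup>2 + 2 \<longleftrightarrow>
      (\<forall>x\<in>V. \<forall>y\<in>V. x \<noteq> y \<longrightarrow> (x, y) \<notin> E \<longrightarrow> d x y = 2)"
    using sum_g pairs by linarith
qed

text \<open>
  If no distance exceeds 2, the neighbour \<open>u\<close> of a leaf is adjacent to every other node, and an edge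
  avoiding \<open>u\<close> would join two nodes at the same distance from \<open>u\<close>. So \<open>u\<close> is the centre.
\<close>

lemma tree_metric_diameter_two_iff_star:
  assumes T: "tree_metric d V E"
  shows "(\<forall>x\<in>V. \<forall>y\<in>V. x \<noteq> y \<longrightarrow> (x, y) \<notin> E \<longrightarrow> d x y = 2) \<longleftrightarrow>
    (\<exists>c\<in>V. \<forall>x\<in>V. \<forall>y\<in>V. (x, y) \<in> E \<longleftrightarrow> x \<noteq> y \<and> (x = c \<or> y = c))" (is "?L \<longleftrightarrow> ?R")
proof
  assume L: ?L
  show ?R
    using T
  proof (cases rule: tree_metric.cases)
    case (vertex v)
    then show ?thesis by simp
  next
    case (leaf U F u w)
    have near: "d x u = 1" if "x \<in> V" "x \<noteq> u" for x
    proof (cases "x = w")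
      case True
      then show ?thesis using leaf tree_metric_refl[OF \<open>tree_metric d U F\<close> \<open>u \<in> U\<close>] by simp
    next
      case False
      then have x: "x \<in> U" using that leaf by simp
      have "x \<noteq> w" "w \<in> V" "x \<in> V" "(x, w) \<notin> E"
        using x leaf that tree_metric_edges_subset[OF \<open>tree_metric d U F\<close>] by auto
      then have "d x w = 2" using L by blast
      then show ?thesis using leaf x by simp
    qed
    have u: "u \<in> V" using leaf by simp
    have "(x, y) \<in> E \<longleftrightarrow> x \<noteq> y \<and> (x = u \<or> y = u)" if x: "x \<in> V" and y: "y \<in> V" for x y
    proof
      assume e: "(x, y) \<in> E"
      then have "d x y = 1" using tree_metric_edge_iff[OF T x y] by simp
      then have "x \<noteq> y" using tree_metric_refl[OF T x] by auto
      moreover have "x = u \<or> y = u"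
      proof (rule ccontr)
        assume "\<not> (x = u \<or> y = u)"
        then show False
          using tree_metric_adjacent_differ[OF T e u] near[OF x] near[OF y] by simp
      qed
      ultimately show "x \<noteq> y \<and> (x = u \<or> y = u)" by simp
    next
      assume "x \<noteq> y \<and> (x = u \<or> y = u)"
      then have "d x y = 1"
        using near[OF x] near[OF y] tree_metric_sym[OF T x y] by metis
      then show "(x, y) \<in> E" using tree_metric_edge_iff[OF T x y] by simp
    qed
    then show ?thesis using u by blast
  qed
next
  assume ?R
  then obtain c where c: "c \<in> V" and
    E: "\<And>x y. x \<in> V \<Longrightarrow> y \<in> V \<Longrightarrow> (x, y) \<in> E \<longleftrightarrow> x \<noteq> y \<and> (x = c \<or> y = c)" by blast
  have "d x y = 2" if x: "x \<in> V" and y: "y \<in> V" and "x \<noteq> y" "(x, y) \<notin> E" for x y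
  proof -
    have "x \<noteq> c" "y \<noteq> c" using E[OF x y] that by auto
    then have xc: "(x, c) \<in> E" and cy: "(c, y) \<in> E" using E c x y by auto
    have "d c y = 1" using tree_metric_edge_iff[OF T c y] cy by simp
    moreover have "d x y \<noteq> 1" using tree_metric_edge_iff[OF T x y] that by simp
    moreover have "d x y \<noteq> 0" using tree_metric_pos[OF T x y] that by simp
    ultimately show ?thesis using tree_metric_adjacent_differ[OF T xc y] by auto
  qed
  then show ?L by blast
qed

lemma sum_nat_dist_lessThan: "3 * (\<Sum>i<n. \<Sum>j<n. (i - j) + (j - i)) + n = (n :: nat) ^ 3"
proof (induction n)
  case (Suc n)
  have half: "2 * (\<Sum>j<n. n - j) = n * (n + 1)"
  proof -
    have "(\<Sum>j<n. n - j) = (\<Sum>j<n. Suc j)"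
      by (rule sum.reindex_bij_witness[of _ "\<lambda>j. n - Suc j" "\<lambda>j. n - Suc j"]) auto
    also have "2 * \<dots> = n * (n + 1)" by (induction n) auto
    finally show ?thesis .
  qed
  have "(\<Sum>i<Suc n. \<Sum>j<Suc n. (i - j) + (j - i))
      = (\<Sum>j<n. n - j) + (\<Sum>i<n. n - i) + (\<Sum>i<n. \<Sum>j<n. (i - j) + (j - i))"
    unfolding lessThan_Suc by (subst sum_insert_square) auto
  then show ?case using Suc half by (simp add: power3_eq_cube algebra_simps)
qed simp

text \<open>
  A numbering of the nodes along a path is 1-Lipschitz, so distances in a path are at least the
  differences of the numbers; their sum is the extremal value, hence the upper bound is attained.
\<close>

lemma tree_metric_total_max_iff_path:
  assumes T: "tree_metric d V E"
  shows "3 * (\<Sum>x\<in>V. \<Sum>y\<in>V. d x y) + card V = card V ^ 3 \<longleftrightarrow>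
    (\<exists>f. bij_betw f V {0..<card V} \<and>
      (\<forall>x\<in>V. \<forall>y\<in>V. (x, y) \<in> E \<longleftrightarrow> f x = Suc (f y) \<or> f y = Suc (f x)))" (is "?L \<longleftrightarrow> ?R")
proof
  assume ?L
  from tree_metric_total_max_imp_transmission_max[OF T this]
  obtain x where x: "x \<in> V" "2 * (\<Sum>y\<in>V. d x y) = card V * (card V - 1)" by blast
  note path = tree_metric_path_if_transmission_max[OF T x]
  have "d x ` V \<subseteq> {0..<card V}" using tree_metric_less_card[OF T x(1)] by auto
  moreover have "card (d x ` V) = card V" using path by (simp add: card_image)
  ultimately have "d x ` V = {0..<card V}" by (intro card_subset_eq) auto
  then show ?R using path by (intro exI[of _ "d x"]) (auto simp: bij_betw_def)
next
  assume ?R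
  then obtain f where bij: "bij_betw f V {0..<card V}" and
    E: "\<And>x y. x \<in> V \<Longrightarrow> y \<in> V \<Longrightarrow> (x, y) \<in> E \<longleftrightarrow> f x = Suc (f y) \<or> f y = Suc (f x)" by blast
  have ge: "(f x - f y) + (f y - f x) \<le> d x y" if xy: "x \<in> V" "y \<in> V" for x y
  proof -
    have "\<bar>int (f x) - int (f y)\<bar> \<le> int (d x y)"
    proof (rule tree_metric_lipschitz_le[OF T _ xy])
      fix x y assume e: "(x, y) \<in> E"
      then have "x \<in> V" "y \<in> V" using tree_metric_edges_subset[OF T] by auto
      then show "\<bar>int (f x) - int (f y)\<bar> \<le> 1" using E[of x y] e by auto
    qed
    then show ?thesis by linarith
  qed
  have "(\<Sum>i<card V. \<Sum>j<card V. (i - j) + (j - i)) = (\<Sum>x\<in>V. \<Sum>y\<in>V. (f x - f y) + (f y - f x))"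
    unfolding atLeast0LessThan[symmetric] sum.reindex_bij_betw[OF bij, symmetric] ..
  also have "\<dots> \<le> (\<Sum>x\<in>V. \<Sum>y\<in>V. d x y)" by (intro sum_mono ge)
  finally show ?L
    using sum_nat_dist_lessThan[of "card V"] tree_metric_total_le[OF T] by linarith
qed

section \<open>Undirected trees and isomorphisms\<close>

lemma arcs_of_vertex_list:
  assumes "xs \<noteq> []" "successively (\<lambda>a b. (a, b) \<in> E) xs" "(last xs, y) \<in> E"
  defines "p \<equiv> zip xs (tl xs @ [y])"
  shows "pcas (hd xs) p y \<and> pawalk_verts (hd xs) p = xs @ [y] \<and> set p \<subseteq> E"
  using assms(1-3) unfolding p_def
proof (induction xs)
  case (Cons x xs)
  then show ?case by (cases xs) auto
qed simp

lemma undirected_tree_no_cycle: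
  assumes "undirected_tree G" and "distinct xs" "3 \<le> length xs"
    and "successively (\<lambda>a b. (a, b) \<in> parcs G) xs"
  shows "(last xs, hd xs) \<notin> parcs G"
proof
  assume e: "(last xs, hd xs) \<in> parcs G"
  interpret pair_graph G using assms(1) by (simp add: undirected_tree_def)
  have ne: "xs \<noteq> []" using assms(3) by auto
  define p where "p = zip xs (tl xs @ [hd xs])"
  note p = arcs_of_vertex_list[OF ne assms(4) e, folded p_def]
  have "hd xs \<in> pverts G" using in_arcsD2[OF e] .
  moreover have "distinct (tl (pawalk_verts (hd xs) p))"
    using p assms(2) ne by (cases xs) auto
  moreover have "length p = length xs" using ne by (simp add: p_def)
  ultimately have "cycle p"
    using p assms(3) unfolding cycle_def awalk_def by auto
  then show False
    using assms(1,3) \<open>length p = length xs\<close> unfolding undirected_tree_def by auto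
qed

text \<open>
  Connectivity in the form in which a subtree grows by one node.
\<close>

lemma undirected_tree_crossing_edge:
  assumes G: "undirected_tree G" and U: "U \<subseteq> pverts G" "U \<noteq> {}" "U \<noteq> pverts G"
  obtains u w where "u \<in> U" "w \<in> pverts G - U" "(u, w) \<in> parcs G"
proof -
  interpret pair_graph G using G by (simp add: undirected_tree_def)
  have symE: "parcs (mk_symmetric (with_proj G)) = parcs G"
    by (auto simp: parcs_mk_symmetric intro: arcs_symmetric)
  obtain a b where ab: "a \<in> U" "b \<in> pverts G" "b \<notin> U" using U by blast
  then have "(a, b) \<in> rtrancl_on (pverts G) (parcs G)"
    using G U unfolding undirected_tree_def connected_def strongly_connected_def reachable_def
    by (auto simp: symE)
  then have "b \<in> U \<or> (\<exists>u\<in>U. \<exists>w\<in>pverts G - U. (u, w) \<in> parcs G)"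
    by (induction rule: rtrancl_on_induct) (use ab in auto)
  then show thesis using ab that by blast
qed

text \<open>
  A subtree is grown one node at a time along crossing edges. The subgraph stays induced because a
  second neighbour of the new node in the subtree would close a cycle with the path between the two
  neighbours.
\<close>

theorem undirected_tree_has_tree_metric:
  assumes G: "undirected_tree G"
  obtains d where "tree_metric d (pverts G) (parcs G)"
proof -
  interpret pair_graph G using G by (simp add: undirected_tree_def)
  have ne: "pverts G \<noteq> {}"
    using G by (auto simp: undirected_tree_def connected_def strongly_connected_def)
  have grow: "Suc k \<le> card (pverts G) \<Longrightarrow>
    \<exists>U d. U \<subseteq> pverts G \<and> card U = Suc k \<and> tree_metric d U (parcs G \<inter> U \<times> U)" for k
  proof (induction k)
    case 0
    obtain v where v: "v \<in> pverts G" using ne by blast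
    have "parcs G \<inter> {v} \<times> {v} = {}" using no_loops' by auto
    moreover have "tree_metric (\<lambda>_ _. 0) {v} {}" by (rule tree_metric.vertex) simp
    ultimately show ?case using v by (intro exI[of _ "{v}"] exI[of _ "\<lambda>_ _. 0"]) simp
  next
    case (Suc k)
    then obtain U d where U: "U \<subseteq> pverts G" "card U = Suc k"
      and T: "tree_metric d U (parcs G \<inter> U \<times> U)" by auto
    have "U \<noteq> pverts G" using Suc.prems U by auto
    then obtain u w where u: "u \<in> U" and w: "w \<in> pverts G" "w \<notin> U" and e: "(u, w) \<in> parcs G"
      using undirected_tree_crossing_edge[OF G U(1)] tree_metric_nonempty[OF T] by blast
    have unique: "x = u" if x: "x \<in> U" and wx: "(x, w) \<in> parcs G" for x
    proof (rule ccontr)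
      assume "x \<noteq> u"
      obtain xs where xs: "xs \<noteq> []" "hd xs = u" "last xs = x" "distinct xs" "set xs \<subseteq> U"
        "successively (\<lambda>a b. (a, b) \<in> parcs G \<inter> U \<times> U) xs"
        using tree_metric_path[OF T u x] by blast
      have len: "2 \<le> length xs"
      proof (cases xs)
        case (Cons a ys)
        then show ?thesis using xs(2,3) \<open>x \<noteq> u\<close> by (cases ys) auto
      qed (use xs in simp)
      have "successively (\<lambda>a b. (a, b) \<in> parcs G) xs"
        using xs(6) by (rule successively_mono) auto
      then have "successively (\<lambda>a b. (a, b) \<in> parcs G) (w # xs)"
        unfolding successively_Cons using xs(2) arcs_symmetric[OF e] by blast
      moreover have "distinct (w # xs)" using xs(4,5) w(2) by auto
      ultimately have "(last (w # xs), hd (w # xs)) \<notin> parcs G"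
        using len by (intro undirected_tree_no_cycle[OF G]) auto
      then show False using xs(1,3) wx by simp
    qed
    define d' where "d' x y = (if x = w then if y = w then 0 else Suc (d u y)
      else if y = w then Suc (d x u) else d x y)" for x y
    have "tree_metric d' U (parcs G \<inter> U \<times> U)"
      using T by (rule tree_metric_cong) (use w(2) in \<open>auto simp: d'_def\<close>)
    then have "tree_metric d' (insert w U) (insert (u, w) (insert (w, u) (parcs G \<inter> U \<times> U)))"
      by (rule tree_metric.leaf) (use u w(2) in \<open>auto simp: d'_def\<close>)
    moreover have "insert (u, w) (insert (w, u) (parcs G \<inter> U \<times> U)) = parcs G \<inter> insert w U \<times> insert w U"
    proof (intro equalityI subsetI)
      fix a assume "a \<in> insert (u, w) (insert (w, u) (parcs G \<inter> U \<times> U))"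
      then show "a \<in> parcs G \<inter> insert w U \<times> insert w U"
        using u e arcs_symmetric[OF e] by blast
    next
      fix a assume "a \<in> parcs G \<inter> insert w U \<times> insert w U"
      then obtain x y where a: "a = (x, y)" "(x, y) \<in> parcs G" "x = w \<or> x \<in> U" "y = w \<or> y \<in> U"
        by blast
      then show "a \<in> insert (u, w) (insert (w, u) (parcs G \<inter> U \<times> U))"
        using unique[of x] unique[of y] arcs_symmetric[OF a(2)] no_loops'[OF a(2)] by blast
    qed
    moreover have "card (insert w U) = Suc (Suc k)"
      using U w(2) tree_metric_finite[OF T] by simp
    ultimately show ?case using U(1) w(1) by (intro exI[of _ "insert w U"] exI[of _ d']) auto
  qed
  have "card (pverts G) > 0" using ne pair_finite_verts by (simp add: card_gt_0_iff)
  then obtain k where k: "card (pverts G) = Suc k" by (auto simp: gr0_conv_Suc)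
  obtain U d where U: "U \<subseteq> pverts G" "card U = Suc k" "tree_metric d U (parcs G \<inter> U \<times> U)"
    using grow[of k] k by auto
  have "U = pverts G" using U k pair_finite_verts by (metis card_subset_eq)
  moreover have "parcs G \<inter> pverts G \<times> pverts G = parcs G" using wellformed' by auto
  ultimately show thesis using U(3) that by simp
qed

text \<open>
  Between graphs whose arcs are pairs of nodes, the arc map of an isomorphism is forced by its node
  map.
\<close>

lemma graph_iso_iff:
  assumes "pair_wf_digraph G" and H: "parcs H \<subseteq> pverts H \<times> pverts H"
  shows "graph_iso G H \<longleftrightarrow> (\<exists>f. bij_betw f (pverts G) (pverts H) \<and>
    (\<forall>x\<in>pverts G. \<forall>y\<in>pverts G. (x, y) \<in> parcs G \<longleftrightarrow> (f x, f y) \<in> parcs H))" (is "_ \<longleftrightarrow> ?R")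
proof -
  interpret pair_wf_digraph G by fact
  show ?thesis
  proof
    assume "graph_iso G H"
    then obtain h where h: "digraph_isomorphism h" and eq: "with_proj H = app_iso h (with_proj G)"
      unfolding graph_iso_def digraph_iso_def by blast
    let ?f = "iso_verts h"
    have fst: "iso_tail h = fst" and snd: "iso_head h = snd"
      using arg_cong[OF eq, of tail] arg_cong[OF eq, of head] by simp_all
    have inj: "inj_on ?f (pverts G)" using h by (simp add: digraph_isomorphism_def)
    have vH: "pverts H = ?f ` pverts G" using arg_cong[OF eq, of verts] by simp
    have arc: "iso_arcs h (x, y) = (?f x, ?f y)" if "(x, y) \<in> parcs G" for x y
      using h that fst snd by (auto simp: digraph_isomorphism_def prod_eq_iff)
    have "parcs H = iso_arcs h ` parcs G" using arg_cong[OF eq, of arcs] by simp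
    also have "\<dots> = (\<lambda>(x, y). (?f x, ?f y)) ` parcs G"
      using arc by (intro image_cong) auto
    finally have aH: "parcs H = (\<lambda>(x, y). (?f x, ?f y)) ` parcs G" .
    show ?R
    proof (intro exI[of _ ?f] conjI ballI)
      show "bij_betw ?f (pverts G) (pverts H)" using inj vH by (simp add: bij_betw_def)
      fix x y assume "x \<in> pverts G" "y \<in> pverts G"
      then show "(x, y) \<in> parcs G \<longleftrightarrow> (?f x, ?f y) \<in> parcs H"
        unfolding aH using inj wellformed' by (auto dest!: inj_onD[OF inj])
    qed
  next
    assume ?R
    then obtain f where f: "bij_betw f (pverts G) (pverts H)"
      and E: "\<And>x y. x \<in> pverts G \<Longrightarrow> y \<in> pverts G \<Longrightarrow> (x, y) \<in> parcs G \<longleftrightarrow> (f x, f y) \<in> parcs H"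
      by blast
    have inj: "inj_on f (pverts G)" and im: "f ` pverts G = pverts H"
      using f by (auto simp: bij_betw_def)
    define h where "h = \<lparr> iso_verts = f, iso_arcs = (\<lambda>(x, y). (f x, f y)),
      iso_head = snd, iso_tail = fst \<rparr>"
    have "inj_on (\<lambda>(x, y). (f x, f y)) (parcs G)"
      using wellformed' by (auto simp: inj_on_def dest!: inj_onD[OF inj])
    then have "digraph_isomorphism h"
      using inj wf_digraph_axioms by (auto simp: digraph_isomorphism_def h_def)
    moreover have "parcs H = (\<lambda>(x, y). (f x, f y)) ` parcs G"
    proof
      show "parcs H \<subseteq> (\<lambda>(x, y). (f x, f y)) ` parcs G"
      proof
        fix p assume p: "p \<in> parcs H"
        then have "fst p \<in> f ` pverts G" "snd p \<in> f ` pverts G" using H im by auto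
        then obtain x y where xy: "x \<in> pverts G" "y \<in> pverts G" "p = (f x, f y)"
          by (metis imageE prod.collapse)
        then have "(x, y) \<in> parcs G" using p E by simp
        then show "p \<in> (\<lambda>(x, y). (f x, f y)) ` parcs G" using xy(3) by (intro image_eqI[of _ _ "(x, y)"]) simp_all
      qed
      show "(\<lambda>(x, y). (f x, f y)) ` parcs G \<subseteq> parcs H"
      proof
        fix p assume "p \<in> (\<lambda>(x, y). (f x, f y)) ` parcs G"
        then obtain x y where xy: "(x, y) \<in> parcs G" "p = (f x, f y)" by auto
        then show "p \<in> parcs H" using E[OF in_arcsD1[OF xy(1)] in_arcsD2[OF xy(1)]] by simp
      qed
    qed
    then have "with_proj H = app_iso h (with_proj G)"
      using im by (simp add: app_iso_def with_proj_def h_def)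
    ultimately show "graph_iso G H"
      unfolding graph_iso_def digraph_iso_def by blast
  qed
qed

lemma star_graph_verts: "pverts (star_graph n) = {0..<n}"
  by (simp add: star_graph_def)

lemma star_graph_arcs: "parcs (star_graph n) \<subseteq> pverts (star_graph n) \<times> pverts (star_graph n)"
  by (auto simp: star_graph_def)

lemma graph_iso_star_iff:
  assumes "pair_wf_digraph G" and V: "pverts G = {0..<n}" and n: "0 < n"
  shows "graph_iso G (star_graph n) \<longleftrightarrow>
    (\<exists>c\<in>{0..<n}. \<forall>x\<in>{0..<n}. \<forall>y\<in>{0..<n}. (x, y) \<in> parcs G \<longleftrightarrow> x \<noteq> y \<and> (x = c \<or> y = c))"
    (is "_ \<longleftrightarrow> ?R")
proof -
  have "graph_iso G (star_graph n) \<longleftrightarrow> (\<exists>f. bij_betw f {0..<n} {0..<n} \<and>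
    (\<forall>x\<in>{0..<n}. \<forall>y\<in>{0..<n}. (x, y) \<in> parcs G \<longleftrightarrow> (f x, f y) \<in> parcs (star_graph n)))"
    unfolding graph_iso_iff[OF assms(1) star_graph_arcs] star_graph_verts V ..
  also have "\<dots> \<longleftrightarrow> ?R"
  proof
    assume "\<exists>f. bij_betw f {0..<n} {0..<n} \<and>
      (\<forall>x\<in>{0..<n}. \<forall>y\<in>{0..<n}. (x, y) \<in> parcs G \<longleftrightarrow> (f x, f y) \<in> parcs (star_graph n))"
    then obtain f where f: "bij_betw f {0..<n} {0..<n}"
      and E: "\<And>x y. x \<in> {0..<n} \<Longrightarrow> y \<in> {0..<n} \<Longrightarrow> (x, y) \<in> parcs G \<longleftrightarrow> (f x, f y) \<in> parcs (star_graph n)"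
      by blast
    have inj: "inj_on f {0..<n}" and im: "f ` {0..<n} = {0..<n}" using f by (auto simp: bij_betw_def)
    have "0 \<in> f ` {0..<n}" unfolding im using n by simp
    then obtain c where c: "c \<in> {0..<n}" "f c = 0" by auto
    have "(x, y) \<in> parcs G \<longleftrightarrow> x \<noteq> y \<and> (x = c \<or> y = c)" if xy: "x \<in> {0..<n}" "y \<in> {0..<n}" for x y
    proof -
      have "f x = 0 \<longleftrightarrow> x = c" "f y = 0 \<longleftrightarrow> y = c" "f x = f y \<longleftrightarrow> x = y"
        using inj_on_eq_iff[OF inj, of x c] inj_on_eq_iff[OF inj, of y c] inj_on_eq_iff[OF inj, of x y]
          c xy by simp_all
      moreover have "f x < n" "f y < n" using xy im by auto
      ultimately show ?thesis unfolding E[OF xy] by (simp add: star_graph_def)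
    qed
    then show ?R using c(1) by blast
  next
    assume ?R
    then obtain c where c: "c \<in> {0..<n}"
      and E: "\<And>x y. x \<in> {0..<n} \<Longrightarrow> y \<in> {0..<n} \<Longrightarrow> (x, y) \<in> parcs G \<longleftrightarrow> x \<noteq> y \<and> (x = c \<or> y = c)"
      by blast
    (* The transposition of the centre c with the centre 0 of the standard star. *)
    let ?f = "\<lambda>x. if x = c then 0 else if x = 0 then c else x"
    have "bij_betw ?f {0..<n} {0..<n}"
      by (rule bij_betw_byWitness[of _ ?f]) (use c n in auto)
    moreover have "(x, y) \<in> parcs G \<longleftrightarrow> (?f x, ?f y) \<in> parcs (star_graph n)"
      if "x \<in> {0..<n}" "y \<in> {0..<n}" for x y
      unfolding E[OF that] using that c by (auto simp: star_graph_def)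
    ultimately show "\<exists>f. bij_betw f {0..<n} {0..<n} \<and>
      (\<forall>x\<in>{0..<n}. \<forall>y\<in>{0..<n}. (x, y) \<in> parcs G \<longleftrightarrow> (f x, f y) \<in> parcs (star_graph n))"
      by (intro exI[of _ ?f]) blast
  qed
  finally show ?thesis .
qed

lemma path_graph_verts: "pverts (path_graph n) = {0..<n}"
  by (simp add: path_graph_def)

lemma path_graph_arcs: "parcs (path_graph n) \<subseteq> pverts (path_graph n) \<times> pverts (path_graph n)"
  by (auto simp: path_graph_def)

lemma graph_iso_path_iff:
  assumes "pair_wf_digraph G" and V: "pverts G = {0..<n}"
  shows "graph_iso G (path_graph n) \<longleftrightarrow> (\<exists>f. bij_betw f {0..<n} {0..<n} \<and>
    (\<forall>x\<in>{0..<n}. \<forall>y\<in>{0..<n}. (x, y) \<in> parcs G \<longleftrightarrow> f x = Suc (f y) \<or> f y = Suc (f x)))"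
proof -
  have key: "(f x, f y) \<in> parcs (path_graph n) \<longleftrightarrow> f x = Suc (f y) \<or> f y = Suc (f x)"
    if "bij_betw f {0..<n} {0..<n}" "x \<in> {0..<n}" "y \<in> {0..<n}" for f x y
    using that bij_betwE[OF that(1)] by (auto simp: path_graph_def)
  have iso: "graph_iso G (path_graph n) \<longleftrightarrow> (\<exists>f. bij_betw f {0..<n} {0..<n} \<and>
    (\<forall>x\<in>{0..<n}. \<forall>y\<in>{0..<n}. (x, y) \<in> parcs G \<longleftrightarrow> (f x, f y) \<in> parcs (path_graph n)))"
    unfolding graph_iso_iff[OF assms(1) path_graph_arcs] path_graph_verts V ..
  show ?thesis
    unfolding iso by (intro ex_cong1 conj_cong refl ball_cong) (simp only: key)
qed

section \<open>The performance measure of a tree\<close>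

lemma laplacian_eq_weighted_laplacian:
  assumes "pair_graph G" and V: "pverts G = {0..<n}"
  shows "laplacian G = weighted_laplacian n (\<lambda>i j. of_bool ((i, j) \<in> parcs G))"
proof -
  interpret pair_graph G by fact
  have deg: "real (out_degree (with_proj G) i) = (\<Sum>k<n. of_bool ((i, k) \<in> parcs G))" for i
  proof -
    have "out_arcs (with_proj G) i = Pair i ` ({..<n} \<inter> {k. (i, k) \<in> parcs G})"
      using in_arcsD2 V by (auto simp: out_arcs_def)
    then have "out_degree (with_proj G) i = card ({..<n} \<inter> {k. (i, k) \<in> parcs G})"
      by (simp add: out_degree_def card_image inj_on_def)
    then show ?thesis by simp
  qed
  show ?thesis
    by (rule eq_matI)
      (auto simp: laplacian_def degree_matrix_def adjacency_matrix_def weighted_laplacian_def V deg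
        simp del: sum_of_bool_eq)
qed

theorem rho_ss_undirected_tree:
  assumes G: "undirected_tree G" and V: "pverts G = {0..<n}"
    and T: "tree_metric d {0..<n} (parcs G)"
  shows "rho_ss (laplacian G) = real (\<Sum>x\<in>{0..<n}. \<Sum>y\<in>{0..<n}. d x y) / (4 * real n)"
proof -
  let ?a = "\<lambda>i j. of_bool ((i, j) \<in> parcs G) :: real"
  interpret pair_graph G using G by (simp add: undirected_tree_def)
  have n: "0 < n" using tree_metric_nonempty[OF T] by auto
  have "rho_ss (weighted_laplacian n ?a) = (\<Sum>i<n. \<Sum>j<n. real (d i j)) / (4 * real n)"
  proof (rule rho_ss_eq_sum_distances[OF n, where \<tau> = "\<lambda>i. 2 - (\<Sum>k<n. ?a i k)"])
    show "?a i j = ?a j i" for i j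
      using arcs_symmetric by (auto simp: of_bool_def)
    show "real (d i j) = real (d j i)" if "i < n" "j < n" for i j
      using tree_metric_sym[OF T] that by simp
    show "real (d i i) = 0" if "i < n" for i
      using tree_metric_refl[OF T] that by simp
    show "(\<Sum>k<n. ?a i k * (real (d i j) - real (d k j)))
        = 2 - (\<Sum>k<n. ?a i k) - (if i = j then 2 else 0)" if "i < n" "j < n" for i j
      using tree_metric_laplace[OF T, of i j] that unfolding atLeast0LessThan by simp
  qed simp
  then show ?thesis
    using laplacian_eq_weighted_laplacian[OF _ V] pair_graph_axioms by (simp add: atLeast0LessThan)
qed

theorem theorem4:
  fixes T :: "nat pair_pre_digraph" and n :: nat
  assumes "undirected_tree T"
    and "pverts T = {0..<n}"
    and "n \<ge> 5"
  shows "(real n - 1)\<^sup>2 / (2 * real n) \<le> rho_ss (laplacian T)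
    \<and> rho_ss (laplacian T) \<le> ((real n)\<^sup>2 - 1) / 12
    \<and> (rho_ss (laplacian T) = (real n - 1)\<^sup>2 / (2 * real n) \<longleftrightarrow> graph_iso T (star_graph n))
    \<and> (rho_ss (laplacian T) = ((real n)\<^sup>2 - 1) / 12 \<longleftrightarrow> graph_iso T (path_graph n))"
proof -
  interpret pair_graph T using assms(1) by (simp add: undirected_tree_def)
  have wf: "pair_wf_digraph T" by (rule pair_wf_digraph)
  obtain d where d: "tree_metric d {0..<n} (parcs T)"
    using undirected_tree_has_tree_metric[OF assms(1)] assms(2) by auto
  define S where "S = (\<Sum>x\<in>{0..<n}. \<Sum>y\<in>{0..<n}. d x y)"
  have rho: "rho_ss (laplacian T) = real S / (4 * real n)"
    using rho_ss_undirected_tree[OF assms(1,2) d] by (simp add: S_def)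
  have n: "0 < n" using assms(3) by simp
  have lower: "2 * n\<^sup>2 + 2 \<le> S + 4 * n" and upper: "3 * S + n \<le> n ^ 3"
    using tree_metric_total_ge(1)[OF d] tree_metric_total_le[OF d] by (simp_all add: S_def)
  have star: "S + 4 * n = 2 * n\<^sup>2 + 2 \<longleftrightarrow> graph_iso T (star_graph n)"
    using tree_metric_total_ge(2)[OF d] tree_metric_diameter_two_iff_star[OF d]
    unfolding graph_iso_star_iff[OF wf assms(2) n] S_def by simp
  have path: "3 * S + n = n ^ 3 \<longleftrightarrow> graph_iso T (path_graph n)"
    using tree_metric_total_max_iff_path[OF d]
    unfolding graph_iso_path_iff[OF wf assms(2)] S_def by simp
  have lower': "2 * (real n)\<^sup>2 + 2 \<le> real S + 4 * real n"
    using of_nat_mono[OF lower, where ?'a = real] by simp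
  have upper': "3 * real S + real n \<le> real n ^ 3"
    using of_nat_mono[OF upper, where ?'a = real] by simp
  have star': "S + 4 * n = 2 * n\<^sup>2 + 2 \<longleftrightarrow> real S + 4 * real n = 2 * (real n)\<^sup>2 + 2"
    using of_nat_eq_iff[of "S + 4 * n" "2 * n\<^sup>2 + 2", where ?'a = real]
    by (simp add: add.commute)
  have path': "3 * S + n = n ^ 3 \<longleftrightarrow> 3 * real S + real n = real n ^ 3"
    using of_nat_eq_iff[of "3 * S + n" "n ^ 3", where ?'a = real] by simp
  have min: "(real n - 1)\<^sup>2 / (2 * real n) = (2 * (real n)\<^sup>2 + 2 - 4 * real n) / (4 * real n)"
    using n by (simp add: field_simps power2_eq_square)
  have max: "((real n)\<^sup>2 - 1) / 12 = ((real n ^ 3 - real n) / 3) / (4 * real n)"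
    using n by (simp add: field_simps power2_eq_square power3_eq_cube)
  have le: "x / (4 * real n) \<le> y / (4 * real n) \<longleftrightarrow> x \<le> y"
    and eq: "x / (4 * real n) = y / (4 * real n) \<longleftrightarrow> x = y" for x y
    using n by (simp_all add: divide_le_cancel)
  show ?thesis
    unfolding rho min max star[symmetric] path[symmetric] star' path' le eq
    using lower' upper' by auto
qed

end
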